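(* Let $(w_i)_{i\in\mathbb{N}}$, $\mathbb{N}=\{1,2,\dots\}$, be a sequence of positive real weights for which there is a $k\in\mathbb{N}$ such that $w_i=1$ for all $i>k$. Let $\mathcal{L}_n^w$ denote the number of leaves of a weighted recursive tree of size $n$ with weight sequence $(w_i)_{i\in\mathbb{N}}$. Then the following hold. 1. $$\mathbb{E}[\mathcal{L}_n^{w}] = \frac{n}{2} + C + \mathcal{O}\left(\frac{1}{n}\right), \quad\text{with } |C| \leq \frac{\sum_{i=1}^{k} w_i + k}{2},$$ where $C$ depends on $k$ and $w_1,\dots,w_k$. 2. $$\mathrm{Var}(\mathcal{L}_n^{w}) = \frac{n}{12} + \mathcal{O}(\sqrt{n}).$$ 3. For all $t>0$, $$\mathbb{P}\left(|\mathcal{L}_n^{w} - \mathbb{E}[\mathcal{L}_n^{w}]|\geq t\right) \leq 2 \exp\left(- \frac{6(t-2k+2)^2}{n-k+2+ \sum_{i=1}^k w_i}\right).$$ 4. As $n\to\infty$, $$\frac{\mathcal{L}^{w}_{n} - \mathbb{E}[\mathcal{L}^{w}_{n}]}{\sqrt{\mathrm{Var}(\mathcal{L}^{w}_{n})}}$$ converges in distribution to a standard normal random variable.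
   Context: Weighted recursive tree (WRT): given positive weights $(w_i)_{i\in\mathbb{N}}$, the WRT of size $n$ is the random rooted tree on nodes $1,\dots,n$ built as follows. Node $1$ is the root; for $j=2,\dots,n$ successively and independently of the previous steps, node $j$ is attached as a child to node $i\in\{1,\dots,j-1\}$ with probability $\frac{w_i}{w_1+\cdots+w_{j-1}}$. A leaf is a node without children. The $\mathcal{O}$-terms are as $n\to\infty$ for a fixed weight sequence.
   Formalization: Items 1 and 3 fail as stated. Proved instead: in 1, error O(1/n) if w_2,...,w_k ≥ 1, and O(1/n + Σ_{i=2}^k n^{-w_i}) in general; in 3, the bound for all n ≥ 1 when t ≥ 2k-2, and for all t > 0 once n is large enough (depending on the weights and k). *)

theory Defs
  imports "HOL-Probability.Probability" "HOL-Library.Landau_Symbols"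
begin

text \<open>
  Weights are functions \<open>w :: nat \<Rightarrow> real\<close> of which only the values at \<open>1, 2, \<dots>\<close> are used.
  \<open>attach_pmf w m\<close> is the law of the node in \<open>{1..m}\<close> to which node \<open>m + 1\<close> is attached.
  As always with \<open>embed_pmf\<close>, the density is meaningful only because it is nonnegative with
  total mass \<open>1\<close>, which holds for positive weights and \<open>m \<ge> 1\<close>; see \<open>pmf_attach_pmf\<close>.
\<close>

definition attach_pmf :: "(nat \<Rightarrow> real) \<Rightarrow> nat \<Rightarrow> nat pmf" where
  "attach_pmf w m = embed_pmf (\<lambda>i. if i \<in> {1..m} then w i / (\<Sum>l=1..m. w l) else 0)"

lemma pmf_attach_pmf:
  assumes "m \<ge> 1" and pos: "\<And>i. i \<in> {1..m} \<Longrightarrow> w i > 0"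
  shows "pmf (attach_pmf w m) i = (if i \<in> {1..m} then w i / (\<Sum>l=1..m. w l) else 0)"
proof -
  let ?S = "\<Sum>l=1..m. w l"
  let ?f = "\<lambda>i. if i \<in> {1..m} then w i / ?S else 0"
  have S: "?S > 0"
    using assms by (intro sum_pos) auto
  have nn: "?f i \<ge> 0" for i
    using S pos[of i] by auto
  have "(\<integral>\<^sup>+ i. ennreal (?f i) \<partial>count_space UNIV) = (\<Sum>i\<in>{1..m}. ennreal (?f i))"
    by (rule nn_integral_count_space'[where A = "{1..m}"]) auto
  also have "\<dots> = ennreal (\<Sum>i\<in>{1..m}. ?f i)"
    using nn by (intro sum_ennreal)
  also have "(\<Sum>i\<in>{1..m}. ?f i) = (\<Sum>i\<in>{1..m}. w i) / ?S"
    by (simp add: sum_divide_distrib[symmetric])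
  also have "\<dots> = 1"
    using S by simp
  finally have "(\<integral>\<^sup>+ i. ennreal (?f i) \<partial>count_space UNIV) = 1"
    by simp
  then show ?thesis
    unfolding attach_pmf_def using nn by (subst pmf_embed_pmf) auto
qed

text \<open>
  A rooted tree on the nodes \<open>{1..n}\<close> with root \<open>1\<close> is encoded by its parent function: node \<open>u\<close> in
  \<open>{2..n}\<close> is a child of \<open>T u\<close>. At all other arguments, in particular at the root, \<open>T\<close> is \<open>0\<close>,
  which is not a node.
\<close>

fun wrt :: "(nat \<Rightarrow> real) \<Rightarrow> nat \<Rightarrow> (nat \<Rightarrow> nat) pmf" where
  "wrt w 0 = return_pmf (\<lambda>_. 0)"
| "wrt w (Suc 0) = return_pmf (\<lambda>_. 0)"
| "wrt w (Suc (Suc m)) =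
     bind_pmf (wrt w (Suc m)) (\<lambda>T.
     bind_pmf (attach_pmf w (Suc m)) (\<lambda>i.
     return_pmf (T(Suc (Suc m) := i))))"

definition leaves :: "nat \<Rightarrow> (nat \<Rightarrow> nat) \<Rightarrow> nat set" where
  "leaves n T = {v \<in> {1..n}. \<not> (\<exists>u\<in>{1..n}. T u = v)}"

definition num_leaves :: "nat \<Rightarrow> (nat \<Rightarrow> nat) \<Rightarrow> real" where
  "num_leaves n T = real (card (leaves n T))"

abbreviation leaves_mean :: "(nat \<Rightarrow> real) \<Rightarrow> nat \<Rightarrow> real" where
  "leaves_mean w n \<equiv> measure_pmf.expectation (wrt w n) (num_leaves n)"

abbreviation leaves_var :: "(nat \<Rightarrow> real) \<Rightarrow> nat \<Rightarrow> real" where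
  "leaves_var w n \<equiv> measure_pmf.variance (wrt w n) (num_leaves n)"

end

theory Submission
  imports Defs
begin

text \<open>
  All nodes after \<open>k\<close> have unit weight, so the number \<open>X\<close> of leaves among them is a Markov chain by
  itself: with total weight \<open>s\<close>, the new node replaces one of these leaves with probability \<open>X / s\<close>
  and otherwise increases \<open>X\<close> by one. The deviation \<open>D = X - s / 2\<close> satisfies
  \<open>E D' = (1 - 1 / s) E D\<close> and \<open>E D'\<^sup>2 = (1 - 2 / s) E D\<^sup>2 + 1 / 4\<close>, which determines the mean exactly
  and the variance up to a bounded error, and \<open>(s - 1) D\<close> is a martingale up to a constant, whose
  increments are centred two-point variables of range \<open>s\<close>. Hoeffding's lemma for these increments
  gives the tail bound. For the central limit theorem, the characteristic function of the
  martingale is multiplied in each step by \<open>exp (- u\<^sup>2 s\<^sup>2 / 8)\<close> up to an error controlled by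
  \<open>E D\<^sup>2\<close>. The leaves among the first \<open>k\<close> nodes number at most \<open>k - 1\<close>, and node \<open>i\<close> is still one of
  them at size \<open>n\<close> with probability of order at most \<open>n powr (- w i)\<close>.
\<close>

section \<open>Expectations over finitely supported distributions\<close>

lemma expectation_bind_finite:
  fixes h :: "'b \<Rightarrow> 'c::{banach, second_countable_topology}"
  assumes "finite (set_pmf p)" "\<And>x. x \<in> set_pmf p \<Longrightarrow> finite (set_pmf (f x))"
  shows "measure_pmf.expectation (bind_pmf p f) h =
    measure_pmf.expectation p (\<lambda>x. measure_pmf.expectation (f x) h)"
proof -
  have "measure_pmf.expectation (bind_pmf p f) h =
      (\<Sum>a\<in>set_pmf p. pmf p a *\<^sub>R measure_pmf.expectation (f a) h)"
    by (rule pmf_expectation_bind) (use assms in auto)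
  also have "\<dots> = measure_pmf.expectation p (\<lambda>x. measure_pmf.expectation (f x) h)"
    by (rule integral_measure_pmf[symmetric]) (use assms in auto)
  finally show ?thesis .
qed

lemma expectation_cong_pmf:
  assumes "\<And>x. x \<in> set_pmf p \<Longrightarrow> f x = g x"
  shows "measure_pmf.expectation p f = measure_pmf.expectation p g"
  by (rule integral_cong_AE) (use assms in \<open>auto simp: AE_measure_pmf_iff\<close>)

lemma expectation_mono_pmf:
  fixes f g :: "'a \<Rightarrow> real"
  assumes "finite (set_pmf p)" "\<And>x. x \<in> set_pmf p \<Longrightarrow> f x \<le> g x"
  shows "measure_pmf.expectation p f \<le> measure_pmf.expectation p g"
  by (rule integral_mono_AE)
    (use assms in \<open>auto simp: AE_measure_pmf_iff integrable_measure_pmf_finite\<close>)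

lemma norm_expectation_le:
  fixes f :: "'a \<Rightarrow> 'b::{banach, second_countable_topology}"
  assumes "finite (set_pmf p)" "\<And>x. x \<in> set_pmf p \<Longrightarrow> norm (f x) \<le> g x"
  shows "norm (measure_pmf.expectation p f) \<le> measure_pmf.expectation p g"
proof -
  have "norm (measure_pmf.expectation p f) \<le> measure_pmf.expectation p (\<lambda>x. norm (f x))"
    by (rule integral_norm_bound)
  also have "\<dots> \<le> measure_pmf.expectation p g"
    by (rule expectation_mono_pmf) (use assms in auto)
  finally show ?thesis .
qed

lemma expectation_affine:
  fixes f :: "'a \<Rightarrow> real"
  assumes "finite (set_pmf p)"
  shows "measure_pmf.expectation p (\<lambda>x. a + b * f x) = a + b * measure_pmf.expectation p f"
  using assms by (simp add: integrable_measure_pmf_finite)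

text \<open>This is the nonnegativity of the variance of \<open>\<bar>f\<bar>\<close>.\<close>

lemma abs_expectation_le_sqrt:
  fixes f :: "'a \<Rightarrow> real"
  assumes "finite (set_pmf p)"
  shows "measure_pmf.expectation p (\<lambda>x. \<bar>f x\<bar>) \<le> sqrt (measure_pmf.expectation p (\<lambda>x. (f x)\<^sup>2))"
proof (rule real_le_rsqrt)
  have int: "integrable (measure_pmf p) g" for g :: "'a \<Rightarrow> real"
    by (rule integrable_measure_pmf_finite[OF assms])
  have "0 \<le> measure_pmf.variance p (\<lambda>x. \<bar>f x\<bar>)" by simp
  also have "\<dots> = measure_pmf.expectation p (\<lambda>x. \<bar>f x\<bar>\<^sup>2) - (measure_pmf.expectation p (\<lambda>x. \<bar>f x\<bar>))\<^sup>2"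
    by (rule measure_pmf.variance_eq) (rule int)+
  finally show "(measure_pmf.expectation p (\<lambda>x. \<bar>f x\<bar>))\<^sup>2 \<le> measure_pmf.expectation p (\<lambda>x. (f x)\<^sup>2)"
    by simp
qed

lemma expectation_bounds:
  fixes g :: "'a \<Rightarrow> real"
  assumes fin: "finite (set_pmf p)" and g: "\<And>x. x \<in> set_pmf p \<Longrightarrow> a \<le> g x \<and> g x \<le> b"
  shows "a \<le> measure_pmf.expectation p g" "measure_pmf.expectation p g \<le> b"
  using expectation_mono_pmf[OF fin, of "\<lambda>_. a" g] expectation_mono_pmf[OF fin, of g "\<lambda>_. b"] g by auto

text \<open>After centring both functions, the cross term is at most \<open>b\<close> times the
  absolute deviation of \<open>f\<close>, whose mean is at most a standard deviation. This transfers
  the variance of the late leaves to all leaves, \<open>g\<close> being the bounded number of early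
  ones.\<close>

lemma variance_perturbation:
  fixes f g :: "'a \<Rightarrow> real"
  assumes fin: "finite (set_pmf p)" and g: "\<And>x. x \<in> set_pmf p \<Longrightarrow> 0 \<le> g x \<and> g x \<le> b"
  shows "\<bar>measure_pmf.variance p (\<lambda>x. f x + g x) - measure_pmf.variance p f\<bar> \<le>
    2 * b * sqrt (measure_pmf.variance p f) + b\<^sup>2"
proof -
  have int [simp]: "integrable (measure_pmf p) h" for h :: "'a \<Rightarrow> real"
    by (rule integrable_measure_pmf_finite[OF fin])
  define a where "a x = f x - measure_pmf.expectation p f" for x
  define c where "c x = g x - measure_pmf.expectation p g" for x
  have Eg: "0 \<le> measure_pmf.expectation p g" "measure_pmf.expectation p g \<le> b"
    using expectation_bounds[OF fin, of 0 g b] g by auto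
  have c: "\<bar>c x\<bar> \<le> b" if "x \<in> set_pmf p" for x
    using Eg g[OF that] unfolding c_def by linarith
  have b: "b \<ge> 0" using Eg by linarith
  have "f x + g x - measure_pmf.expectation p (\<lambda>x. f x + g x) = a x + c x" for x
    unfolding a_def c_def by simp
  then have "measure_pmf.variance p (\<lambda>x. f x + g x) = measure_pmf.expectation p (\<lambda>x. (a x)\<^sup>2 + (2 * (a x * c x) + (c x)\<^sup>2))"
    by (simp only: power2_sum ac_simps)
  also have "\<dots> = measure_pmf.variance p f + measure_pmf.expectation p (\<lambda>x. 2 * (a x * c x) + (c x)\<^sup>2)"
    by (subst Bochner_Integration.integral_add) (simp_all add: a_def)
  finally have "\<bar>measure_pmf.variance p (\<lambda>x. f x + g x) - measure_pmf.variance p f\<bar> =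
     norm (measure_pmf.expectation p (\<lambda>x. 2 * (a x * c x) + (c x)\<^sup>2))" by simp
  also have "\<dots> \<le> measure_pmf.expectation p (\<lambda>x. b\<^sup>2 + (2 * b) * \<bar>a x\<bar>)"
  proof (rule norm_expectation_le[OF fin])
    fix x assume x: "x \<in> set_pmf p"
    have "\<bar>a x * c x\<bar> \<le> b * \<bar>a x\<bar>"
      unfolding abs_mult using mult_left_mono[OF c[OF x], of "\<bar>a x\<bar>"] by (simp add: mult.commute)
    moreover have "(c x)\<^sup>2 \<le> b\<^sup>2" using c[OF x] by (simp add: abs_le_square_iff[symmetric] b)
    moreover have "0 \<le> (c x)\<^sup>2" by simp
    ultimately show "norm (2 * (a x * c x) + (c x)\<^sup>2) \<le> b\<^sup>2 + (2 * b) * \<bar>a x\<bar>"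
      unfolding real_norm_def by linarith
  qed
  also have "\<dots> = b\<^sup>2 + (2 * b) * measure_pmf.expectation p (\<lambda>x. \<bar>a x\<bar>)"
    by (rule expectation_affine[OF fin])
  also have "\<dots> \<le> b\<^sup>2 + (2 * b) * sqrt (measure_pmf.expectation p (\<lambda>x. (a x)\<^sup>2))"
    using b by (intro add_left_mono mult_left_mono abs_expectation_le_sqrt fin) simp
  finally show ?thesis by (simp add: a_def)
qed

section \<open>The chain of late leaves\<close>

text \<open>The law of the number of late leaves \<open>m\<close> steps after node \<open>k\<close>,
  with \<open>W\<close> the total weight of the first \<open>k\<close> nodes, as
  \<open>map_late_leaves\<close> shows. The outcome \<open>True\<close> means that the new node is
  attached to a late leaf and so replaces it.\<close>

primrec leaf_chain :: "real \<Rightarrow> nat \<Rightarrow> nat pmf" where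
  "leaf_chain W 0 = return_pmf 0"
| "leaf_chain W (Suc m) = bind_pmf (leaf_chain W m)
     (\<lambda>x. map_pmf (\<lambda>b. if b then x else Suc x) (bernoulli_pmf (real x / (W + real m))))"

lemma set_leaf_chain: "set_pmf (leaf_chain W m) \<subseteq> {..m}"
  by (induction m) (auto split: if_splits)

lemma finite_leaf_chain [simp]: "finite (set_pmf (leaf_chain W m))"
  using set_leaf_chain finite_subset by blast

lemma integrable_leaf_chain [simp]:
  fixes f :: "nat \<Rightarrow> 'b::{banach, second_countable_topology}"
  shows "integrable (measure_pmf (leaf_chain W m)) f"
  by (simp add: integrable_measure_pmf_finite)

text \<open>On the support the count is at most \<open>m\<close>, so the Bernoulli parameter is a
  genuine probability.\<close>

lemma leaf_chain_prob_bounds: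
  assumes "W > 0" "x \<in> set_pmf (leaf_chain W m)"
  shows "real x / (W + real m) \<ge> 0" "real x / (W + real m) \<le> 1"
  using assms set_leaf_chain[of W m] by (auto simp: field_simps)

text \<open>One-step averaging, for vector-valued \<open>g\<close> so that it serves real moments
  and complex characteristic functions alike.\<close>

lemma expectation_leaf_chain_Suc:
  fixes g :: "nat \<Rightarrow> 'b::{banach, second_countable_topology}"
  assumes W: "W > 0"
  shows "measure_pmf.expectation (leaf_chain W (Suc m)) g =
    measure_pmf.expectation (leaf_chain W m)
      (\<lambda>x. (real x / (W + real m)) *\<^sub>R g x + (1 - real x / (W + real m)) *\<^sub>R g (Suc x))"
  unfolding leaf_chain.simps
proof (subst expectation_bind_finite; (intro expectation_cong_pmf)?)
  fix x assume x: "x \<in> set_pmf (leaf_chain W m)"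
  note p = leaf_chain_prob_bounds[OF W x]
  show "measure_pmf.expectation
      (map_pmf (\<lambda>b. if b then x else Suc x) (bernoulli_pmf (real x / (W + real m)))) g =
    (real x / (W + real m)) *\<^sub>R g x + (1 - real x / (W + real m)) *\<^sub>R g (Suc x)"
    using p by (subst integral_map_pmf, subst integral_measure_pmf[of UNIV]) (auto simp: UNIV_bool)
qed auto

text \<open>With s = W + m, the centring s / 2 is the affine solution of the mean recursion: at x =
  s / 2 the expected increase 1 - x / s equals 1 / 2, which is also the increase of s / 2.\<close>

definition centred :: "real \<Rightarrow> nat \<Rightarrow> nat \<Rightarrow> real" where
  "centred W m x = real x - (W + real m) / 2"

text \<open>A step multiplies E D by (s - 1) / s while s grows by one, so (s - 1) E D keeps its
  initial value (W - 1) (- W / 2). The product form covers \<open>m = 0\<close>, where W + m - 1 can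
  vanish.\<close>

lemma expectation_centred:
  assumes W: "W > 0"
  shows "(W + real m - 1) * measure_pmf.expectation (leaf_chain W m) (centred W m) = W * (1 - W) / 2"
proof (induction m)
  case 0
  show ?case by (simp add: centred_def field_simps)
next
  case (Suc m)
  let ?s = "W + real m"
  have s: "?s > 0" using W by simp
  have "measure_pmf.expectation (leaf_chain W (Suc m)) (centred W (Suc m)) =
      measure_pmf.expectation (leaf_chain W m) (\<lambda>x. (1 - 1 / ?s) * centred W m x)"
    unfolding expectation_leaf_chain_Suc[OF W]
  proof (intro expectation_cong_pmf)
    fix x
    define p where "p = real x / ?s"
    have x: "real x = p * ?s" using s by (simp add: p_def)
    have c: "centred W m x = (p - 1/2) * ?s" by (simp add: centred_def x algebra_simps)
    have c1: "centred W (Suc m) x = (p - 1/2) * ?s - 1/2" "centred W (Suc m) (Suc x) = (p - 1/2) * ?s + 1/2"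
      using c by (simp_all add: centred_def field_simps)
    show "p *\<^sub>R centred W (Suc m) x + (1 - p) *\<^sub>R centred W (Suc m) (Suc x) = (1 - 1 / ?s) * centred W m x"
      unfolding c c1 using s by (simp add: field_simps)
  qed
  then have "measure_pmf.expectation (leaf_chain W (Suc m)) (centred W (Suc m)) =
      (1 - 1 / ?s) * measure_pmf.expectation (leaf_chain W m) (centred W m)"
    by simp
  then have "?s * measure_pmf.expectation (leaf_chain W (Suc m)) (centred W (Suc m)) =
      (?s - 1) * measure_pmf.expectation (leaf_chain W m) (centred W m)"
    using s by (simp add: field_simps)
  then show ?case using Suc.IH by simp
qed

text \<open>The value s / 12 solves the recursion for E D^2 exactly, since (1 - 2 / s) s / 12 + 1 /
  4 = (s + 1) / 12. The deviation from it is therefore just multiplied by 1 - 2 / s.\<close>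

lemma expectation_centred_sq_Suc:
  assumes W: "W > 0"
  shows "measure_pmf.expectation (leaf_chain W (Suc m)) (\<lambda>x. (centred W (Suc m) x)\<^sup>2) - (W + real (Suc m)) / 12 =
    (1 - 2 / (W + real m)) *
      (measure_pmf.expectation (leaf_chain W m) (\<lambda>x. (centred W m x)\<^sup>2) - (W + real m) / 12)"
proof -
  let ?s = "W + real m"
  have s: "?s > 0" using W by simp
  have "measure_pmf.expectation (leaf_chain W (Suc m)) (\<lambda>x. (centred W (Suc m) x)\<^sup>2) =
      measure_pmf.expectation (leaf_chain W m) (\<lambda>x. (1 - 2 / ?s) * (centred W m x)\<^sup>2 + 1 / 4)"
    unfolding expectation_leaf_chain_Suc[OF W]
  proof (intro expectation_cong_pmf)
    fix x
    define p where "p = real x / ?s"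
    have x: "real x = p * ?s" using s by (simp add: p_def)
    have c: "centred W m x = (p - 1/2) * ?s" by (simp add: centred_def x algebra_simps)
    have c1: "centred W (Suc m) x = (p - 1/2) * ?s - 1/2" "centred W (Suc m) (Suc x) = (p - 1/2) * ?s + 1/2"
      using c by (simp_all add: centred_def field_simps)
    have d: "(1 - 2 / ?s) * ((p - 1/2) * ?s)\<^sup>2 = ((p - 1/2) * ?s)\<^sup>2 - 2 * (p-1/2)\<^sup>2 * ?s"
      using s by (simp add: power2_eq_square field_simps)
    have "p * ((p - 1/2) * ?s - 1/2)\<^sup>2 + (1 - p) * ((p - 1/2) * ?s + 1/2)\<^sup>2
      = ((p - 1/2) * ?s)\<^sup>2 - 2 * (p-1/2)\<^sup>2 * ?s + 1/4"
      by (simp add: power2_eq_square) algebra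
    then show "p *\<^sub>R (centred W (Suc m) x)\<^sup>2 + (1 - p) *\<^sub>R (centred W (Suc m) (Suc x))\<^sup>2 =
        (1 - 2 / ?s) * (centred W m x)\<^sup>2 + 1 / 4"
      unfolding c c1 d by simp
  qed
  then have "measure_pmf.expectation (leaf_chain W (Suc m)) (\<lambda>x. (centred W (Suc m) x)\<^sup>2) =
     (1 - 2 / ?s) * measure_pmf.expectation (leaf_chain W m) (\<lambda>x. (centred W m x)\<^sup>2) + 1 / 4"
    by simp
  then show ?thesis using s by (simp add: field_simps)
qed

text \<open>The factor 1 - 2 / s has modulus at most 1 once s \<ge> 1, hence from
  \<open>m = 1\<close> on. At \<open>m = 0\<close> a small \<open>W\<close> can make it large, so
  \<open>e 0\<close> and \<open>e 1\<close> enter the bound separately.\<close>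

lemma expectation_centred_sq_bounded:
  assumes W: "W > 0"
  shows "\<exists>K\<ge>0. \<forall>m. \<bar>measure_pmf.expectation (leaf_chain W m) (\<lambda>x. (centred W m x)\<^sup>2) - (W + real m) / 12\<bar> \<le> K"
proof -
  define e where "e m = measure_pmf.expectation (leaf_chain W m) (\<lambda>x. (centred W m x)\<^sup>2) - (W + real m) / 12" for m
  have e1: "\<bar>e (Suc m)\<bar> \<le> \<bar>e 1\<bar>" for m
  proof (induction m)
    case (Suc m)
    have "\<bar>1 - 2 / (W + real (Suc m))\<bar> \<le> 1"
      using W by (simp add: abs_le_iff field_simps)
    moreover have "e (Suc (Suc m)) = (1 - 2 / (W + real (Suc m))) * e (Suc m)"
      unfolding e_def by (rule expectation_centred_sq_Suc[OF W])
    ultimately have "\<bar>e (Suc (Suc m))\<bar> \<le> 1 * \<bar>e (Suc m)\<bar>"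
      by (simp only: abs_mult) (intro mult_right_mono, auto)
    with Suc show ?case by simp
  qed simp
  have "\<bar>e m\<bar> \<le> max \<bar>e 0\<bar> \<bar>e 1\<bar>" for m
    using e1[of "m - 1"] by (cases m) auto
  then show ?thesis unfolding e_def[symmetric] by (intro exI[of _ "max \<bar>e 0\<bar> \<bar>e 1\<bar>"]) auto
qed

lemma expectation_leaf_chain:
  assumes W: "W > 0" and m: "m \<ge> 1"
  shows "measure_pmf.expectation (leaf_chain W m) real =
    (W + real m) / 2 + W * (1 - W) / (2 * (W + real m - 1))"
proof -
  have pos: "W + real m - 1 > 0" using W m by simp
  have "measure_pmf.expectation (leaf_chain W m) (centred W m) =
     measure_pmf.expectation (leaf_chain W m) real - (W + real m) / 2"
    unfolding centred_def by simp
  then have *: "(W + real m - 1) * (measure_pmf.expectation (leaf_chain W m) real - (W + real m) / 2) = W * (1 - W) / 2"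
    using expectation_centred[OF W, of m] by simp
  have "measure_pmf.expectation (leaf_chain W m) real - (W + real m) / 2 = W * (1 - W) / 2 / (W + real m - 1)"
    using pos unfolding *[symmetric] by simp
  then show ?thesis by (simp add: field_simps)
qed

text \<open>The variance is E D^2 - (E D)^2. For \<open>m \<ge> 2\<close> the factor W + m - 1 in
  \<open>expectation_centred\<close> is at least 1, so the modulus of E D is at most that of W (1 -
  W) / 2.\<close>

lemma variance_leaf_chain:
  assumes W: "W > 0"
  shows "\<exists>K\<ge>0. \<forall>m\<ge>2. \<bar>measure_pmf.variance (leaf_chain W m) real - (W + real m) / 12\<bar> \<le> K"
proof -
  obtain K where K: "K \<ge> 0" "\<And>m. \<bar>measure_pmf.expectation (leaf_chain W m) (\<lambda>x. (centred W m x)\<^sup>2) - (W + real m) / 12\<bar> \<le> K"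
    using expectation_centred_sq_bounded[OF W] by blast
  define c where "c = W * (1 - W) / 2"
  have "\<bar>measure_pmf.variance (leaf_chain W m) real - (W + real m) / 12\<bar> \<le> K + c\<^sup>2" if m: "m \<ge> 2" for m
  proof -
    let ?e = "measure_pmf.expectation (leaf_chain W m) (centred W m)"
    have y: "W + real m - 1 \<ge> 1" using W m by simp
    have "measure_pmf.expectation (leaf_chain W m) real = ?e + (W + real m) / 2"
      unfolding centred_def by simp
    then have "measure_pmf.variance (leaf_chain W m) real = measure_pmf.variance (leaf_chain W m) (centred W m)"
      by (simp add: centred_def algebra_simps)
    also have "\<dots> = measure_pmf.expectation (leaf_chain W m) (\<lambda>x. (centred W m x)\<^sup>2) - ?e\<^sup>2"
      by (rule measure_pmf.variance_eq) simp_all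
    finally have v: "measure_pmf.variance (leaf_chain W m) real =
      measure_pmf.expectation (leaf_chain W m) (\<lambda>x. (centred W m x)\<^sup>2) - ?e\<^sup>2" .
    have "1 * \<bar>?e\<bar> \<le> \<bar>W + real m - 1\<bar> * \<bar>?e\<bar>"
      by (rule mult_right_mono) (use y in auto)
    also have "\<dots> = \<bar>c\<bar>" unfolding abs_mult[symmetric] expectation_centred[OF W] c_def ..
    finally have "?e\<^sup>2 \<le> c\<^sup>2" by (simp add: abs_le_square_iff)
    moreover have "0 \<le> ?e\<^sup>2" by simp
    ultimately show ?thesis unfolding v using K(2)[of m] by linarith
  qed
  then show ?thesis using K(1) by (intro exI[of _ "K + c\<^sup>2"]) auto
qed

section \<open>Concentration\<close>

text \<open>Hoeffding's lemma for the centred variable that equals p - 1 with probability p and p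
  with probability 1 - p.\<close>

lemma bernoulli_mgf_le:
  fixes p h :: real
  assumes p: "0 \<le> p" "p \<le> 1"
  shows "p * exp (- h * (1 - p)) + (1 - p) * exp (h * p) \<le> exp (h\<^sup>2 / 8)"
proof -
  have key: "exp (- h * q) * (1 + q * (exp h - 1)) \<le> exp (h\<^sup>2 / 8)" if "h \<ge> 0" "0 \<le> q" for h q :: real
  proof -
    have pos: "1 + q * (exp h - 1) > 0"
      using that by (simp add: add_pos_nonneg)
    have "exp (- h * q) * (1 + q * (exp h - 1)) = exp (- h * q + ln (1 + q * (exp h - 1)))"
      using pos by (simp only: exp_add exp_ln)
    also have "\<dots> \<le> exp (h\<^sup>2 / 8)"
      using Hoeffdings_lemma_aux[OF that] by simp
    finally show ?thesis .
  qed
  show ?thesis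
  proof (cases "h \<ge> 0")
    case True
    have "p * exp (- h * (1 - p)) + (1 - p) * exp (h * p) = exp (- h * (1 - p)) * (p + (1 - p) * exp h)"
      by (simp add: exp_diff exp_minus field_simps)
    also have "\<dots> = exp (- h * (1 - p)) * (1 + (1 - p) * (exp h - 1))"
      by (simp add: algebra_simps)
    finally show ?thesis using key[OF True, of "1 - p"] p by simp
  next
    \<comment> \<open>For negative \<open>h\<close> the two values change roles: \<open>-h\<close>
      replaces \<open>h\<close>, and \<open>p\<close> replaces \<open>1 - p\<close>.\<close>
    case False
    have "p * exp (- h * (1 - p)) + (1 - p) * exp (h * p) = exp (- (-h) * p) * (p * exp (-h) + (1 - p))"
      by (simp add: exp_diff exp_minus field_simps)
    also have "\<dots> = exp (- (-h) * p) * (1 + p * (exp (-h) - 1))"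
      by (simp add: algebra_simps)
    finally show ?thesis using key[of "-h" p] p False by simp
  qed
qed

text \<open>By the recursion of \<open>expectation_centred\<close>, the factor \<open>W + m - 1\<close> turns \<open>centred\<close> into a martingale.\<close>

definition leaf_martingale :: "real \<Rightarrow> nat \<Rightarrow> nat \<Rightarrow> real" where
  "leaf_martingale W m x = (W + real m - 1) * centred W m x - W * (1 - W) / 2"

text \<open>With p = x / s, the increment is - s (1 - p) with probability p and s p otherwise: a
  two-point variable of mean zero and range s.\<close>

lemma leaf_martingale_Suc:
  assumes "W > 0"
  shows "leaf_martingale W (Suc m) x = leaf_martingale W m x - (W + real m) * (1 - real x / (W + real m))"
    and "leaf_martingale W (Suc m) (Suc x) = leaf_martingale W m x + (W + real m) * (real x / (W + real m))"
proof -
  have "W + real m \<noteq> 0" using assms by simp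
  then show "leaf_martingale W (Suc m) x = leaf_martingale W m x - (W + real m) * (1 - real x / (W + real m))"
    and "leaf_martingale W (Suc m) (Suc x) = leaf_martingale W m x + (W + real m) * (real x / (W + real m))"
    by (simp_all add: leaf_martingale_def centred_def field_simps)
qed

text \<open>From 0 late leaves none can be hit, so the first step is deterministic. The martingale
  arguments therefore start at time 1.\<close>

lemma expectation_leaf_chain_1:
  fixes g :: "nat \<Rightarrow> 'b::{banach, second_countable_topology}"
  assumes "W > 0"
  shows "measure_pmf.expectation (leaf_chain W (Suc 0)) g = g (Suc 0)"
  by (subst expectation_leaf_chain_Suc[OF assms]) simp

lemma leaf_martingale_1_1 [simp]: "leaf_martingale W (Suc 0) (Suc 0) = 0"
  by (simp add: leaf_martingale_def centred_def field_simps)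

text \<open>The sum of the squared ranges of the martingale increments up to time \<open>m\<close>.
  It starts at \<open>j = 1\<close> because the step from time 0 to time 1 is deterministic.\<close>

definition sqsum :: "real \<Rightarrow> nat \<Rightarrow> real" where
  "sqsum W m = (\<Sum>j=1..<m. (W + real j)\<^sup>2)"

lemma sqsum_Suc: "m \<ge> 1 \<Longrightarrow> sqsum W (Suc m) = sqsum W m + (W + real m)\<^sup>2"
  unfolding sqsum_def by simp

text \<open>The cubic (x - 1) x (2 x - 1) has the increments 6 x^2, so the sum telescopes. The
  closed form yields both the constant of the tail bound and the limiting variance.\<close>

lemma sqsum_eq:
  assumes "m \<ge> 1"
  shows "6 * sqsum W m = (W + real m - 1) * (W + real m) * (2 * (W + real m) - 1) - W * (W + 1) * (2 * W + 1)"
  using assms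
proof (induction m rule: dec_induct)
  case base
  show ?case by (simp add: sqsum_def algebra_simps)
next
  case (step m)
  then show ?case by (simp add: sqsum_Suc power2_eq_square algebra_simps)
qed

text \<open>The Azuma-Hoeffding argument: given the present state, \<open>bernoulli_mgf_le\<close>
  with h = l s bounds the contribution of the next increment by exp ((l s)^2 / 8).\<close>

lemma leaf_martingale_mgf_le:
  assumes W: "W > 0" and "m \<ge> 1"
  shows "measure_pmf.expectation (leaf_chain W m) (\<lambda>x. exp (l * leaf_martingale W m x)) \<le> exp (l\<^sup>2 * sqsum W m / 8)"
  using \<open>m \<ge> 1\<close>
proof (induction m rule: dec_induct)
  case base
  show ?case by (simp add: sqsum_def expectation_leaf_chain_1[OF W] del: leaf_chain.simps)
next
  case (step m)
  define s where "s = W + real m"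
  have "measure_pmf.expectation (leaf_chain W (Suc m)) (\<lambda>x. exp (l * leaf_martingale W (Suc m) x)) \<le>
      measure_pmf.expectation (leaf_chain W m) (\<lambda>x. exp ((l * s)\<^sup>2 / 8) * exp (l * leaf_martingale W m x))"
    unfolding expectation_leaf_chain_Suc[OF W]
  proof (rule expectation_mono_pmf)
    fix x assume x: "x \<in> set_pmf (leaf_chain W m)"
    define p where "p = real x / (W + real m)"
    have p: "0 \<le> p" "p \<le> 1" using leaf_chain_prob_bounds[OF W x] by (auto simp: p_def)
    have "p *\<^sub>R exp (l * leaf_martingale W (Suc m) x) + (1 - p) *\<^sub>R exp (l * leaf_martingale W (Suc m) (Suc x)) =
        exp (l * leaf_martingale W m x) * (p * exp (- (l * s) * (1 - p)) + (1 - p) * exp ((l * s) * p))"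
      unfolding leaf_martingale_Suc[OF W, of m x] p_def[symmetric] unfolding s_def[symmetric]
      by (simp add: ring_distribs exp_add exp_diff exp_minus field_simps)
    also have "\<dots> \<le> exp (l * leaf_martingale W m x) * exp ((l * s)\<^sup>2 / 8)"
      by (intro mult_left_mono bernoulli_mgf_le p) auto
    finally show "p *\<^sub>R exp (l * leaf_martingale W (Suc m) x) + (1 - p) *\<^sub>R exp (l * leaf_martingale W (Suc m) (Suc x)) \<le>
        exp ((l * s)\<^sup>2 / 8) * exp (l * leaf_martingale W m x)" by (simp add: mult.commute)
  qed simp
  also have "\<dots> = exp ((l * s)\<^sup>2 / 8) * measure_pmf.expectation (leaf_chain W m) (\<lambda>x. exp (l * leaf_martingale W m x))"
    by simp
  also have "\<dots> \<le> exp ((l * s)\<^sup>2 / 8) * exp (l\<^sup>2 * sqsum W m / 8)"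
    by (intro mult_left_mono step.IH) auto
  also have "\<dots> = exp (l\<^sup>2 * sqsum W (Suc m) / 8)"
    unfolding exp_add[symmetric] sqsum_Suc[OF step.hyps(1)] s_def power_mult_distrib by (simp add: ring_distribs add_divide_distrib add.commute)
  finally show ?case .
qed

text \<open>Chernoff's bound; the sign \<open>\<sigma>\<close> treats both tails at once. The
  assumption \<open>m \<ge> 2\<close> makes \<open>sqsum W m\<close> positive.\<close>

lemma leaf_martingale_one_sided_tail:
  assumes W: "W > 0" and m: "m \<ge> 2" and r: "r > 0" and sgn: "\<bar>\<sigma>\<bar> = 1"
  shows "measure_pmf.prob (leaf_chain W m) {x. \<sigma> * leaf_martingale W m x \<ge> r} \<le> exp (- 2 * r\<^sup>2 / sqsum W m)"
proof -
  have V: "sqsum W m > 0"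
    unfolding sqsum_def by (rule sum_pos) (use m W in auto)
  \<comment> \<open>The minimiser of l^2 V / 8 - l r for V = \<open>sqsum W m\<close>.\<close>
  define l where "l = 4 * r / sqsum W m"
  have l: "l > 0" using V r by (simp add: l_def)
  have "measure_pmf.prob (leaf_chain W m) {x. \<sigma> * leaf_martingale W m x \<ge> r} =
      measure_pmf.prob (leaf_chain W m) {x \<in> space (measure_pmf (leaf_chain W m)). exp ((l * \<sigma>) * leaf_martingale W m x) \<ge> exp (l * r)}"
    using l by (simp add: mult.assoc)
  also have "\<dots> \<le> measure_pmf.expectation (leaf_chain W m) (\<lambda>x. exp ((l * \<sigma>) * leaf_martingale W m x)) / exp (l * r)"
    by (rule integral_Markov_inequality_measure[where A = UNIV]) auto
  also have "\<dots> \<le> exp ((l * \<sigma>)\<^sup>2 * sqsum W m / 8) / exp (l * r)"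
    using m by (intro divide_right_mono leaf_martingale_mgf_le W) auto
  also have "(l * \<sigma>)\<^sup>2 = l\<^sup>2" using sgn by (simp add: power_mult_distrib abs_square_eq_1)
  also have "exp (l\<^sup>2 * sqsum W m / 8) / exp (l * r) = exp (l\<^sup>2 * sqsum W m / 8 - l * r)"
    by (simp add: exp_diff)
  also have "l\<^sup>2 * sqsum W m / 8 - l * r = - 2 * r\<^sup>2 / sqsum W m"
    unfolding l_def using V by (simp add: power2_eq_square field_simps)
  finally show ?thesis .
qed

lemma leaf_martingale_tail:
  assumes W: "W > 0" and m: "m \<ge> 2" and r: "r > 0"
  shows "measure_pmf.prob (leaf_chain W m) {x. \<bar>leaf_martingale W m x\<bar> \<ge> r} \<le> 2 * exp (- 2 * r\<^sup>2 / sqsum W m)"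
proof -
  have "{x. \<bar>leaf_martingale W m x\<bar> \<ge> r} = {x. 1 * leaf_martingale W m x \<ge> r} \<union> {x. (-1) * leaf_martingale W m x \<ge> r}"
    by auto
  then have "measure_pmf.prob (leaf_chain W m) {x. \<bar>leaf_martingale W m x\<bar> \<ge> r} \<le>
     measure_pmf.prob (leaf_chain W m) {x. 1 * leaf_martingale W m x \<ge> r} + measure_pmf.prob (leaf_chain W m) {x. (-1) * leaf_martingale W m x \<ge> r}"
    by (simp only:) (rule measure_Un_le, auto)
  also have "\<dots> \<le> exp (- 2 * r\<^sup>2 / sqsum W m) + exp (- 2 * r\<^sup>2 / sqsum W m)"
    by (intro add_mono leaf_martingale_one_sided_tail W m r) auto
  finally show ?thesis by simp
qed

text \<open>By \<open>expectation_centred\<close>, the constant subtracted in the martingale is s -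
  1 times the mean of D. Tail bounds and characteristic functions of the martingale thus carry over
  to the late leaves.\<close>

lemma leaf_martingale_eq_deviation:
  assumes "W > 0"
  shows "leaf_martingale W m x = (W + real m - 1) * (real x - measure_pmf.expectation (leaf_chain W m) real)"
proof -
  have "measure_pmf.expectation (leaf_chain W m) (centred W m) =
     measure_pmf.expectation (leaf_chain W m) real - (W + real m) / 2"
    unfolding centred_def by simp
  then have "W * (1 - W) / 2 = (W + real m - 1) * (measure_pmf.expectation (leaf_chain W m) real - (W + real m) / 2)"
    using expectation_centred[OF assms, of m] by simp
  then show ?thesis unfolding leaf_martingale_def centred_def by (simp add: algebra_simps)
qed

lemma leaf_chain_tail:
  assumes W: "W > 0" and m1: "m \<ge> 1" and r: "r > 0"
  shows "measure_pmf.prob (leaf_chain W m)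
      {x. \<bar>real x - measure_pmf.expectation (leaf_chain W m) real\<bar> \<ge> r} \<le>
    2 * exp (- (6 * r\<^sup>2 / (real m + 2 + W)))"
proof (cases "m = 1")
  \<comment> \<open>Here the chain equals 1 with certainty and \<open>sqsum W m\<close> vanishes, so
    the general argument does not apply.\<close>
  case True
  have "measure_pmf.prob (leaf_chain W (Suc 0)) A = indicator A (Suc 0)" for A
    using expectation_leaf_chain_1[OF W, of "indicator A :: nat \<Rightarrow> real"] by simp
  then show ?thesis using True r by (simp add: expectation_leaf_chain_1[OF W] del: leaf_chain.simps)
next
  case False
  then have m: "m \<ge> 2" using m1 by simp
  define y where "y = W + real m - 1"
  have y: "y \<ge> 1" using m W by (simp add: y_def)
  have V: "sqsum W m > 0"
    unfolding sqsum_def by (rule sum_pos) (use m W in auto)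
  have e: "W + real m = y + 1" by (simp add: y_def)
  have "W * (W + 1) * (2 * W + 1) \<ge> 0" using W by simp
  moreover have "6 * sqsum W m = (y + 1 - 1) * (y + 1) * (2 * (y + 1) - 1) - W * (W + 1) * (2 * W + 1)"
    using sqsum_eq[of m W] m unfolding e by simp
  ultimately have "6 * sqsum W m \<le> (y + 1 - 1) * (y + 1) * (2 * (y + 1) - 1)"
    by linarith
  then have "6 * sqsum W m \<le> y * (y + 1) * (2 * y + 1)" by (simp add: add.commute)
  \<comment> \<open>The comparison value 2 (y + 3) y^2 lets y^2 cancel against (y r)^2 and leaves
    the desired denominator y + 3 = m + 2 + W. The difference y (3 y - 1) is nonnegative because y
    \<ge> 1.\<close>
  also have "\<dots> = 2 * (y + 3) * y\<^sup>2 - y * (3 * y - 1)"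
    by (simp add: power2_eq_square algebra_simps)
  also have "\<dots> \<le> 2 * (y + 3) * y\<^sup>2" using y by simp
  finally have *: "3 * sqsum W m \<le> (y + 3) * y\<^sup>2" by (simp add: distrib_right)
  have "{x. \<bar>real x - measure_pmf.expectation (leaf_chain W m) real\<bar> \<ge> r} = {x. \<bar>leaf_martingale W m x\<bar> \<ge> y * r}"
    using y unfolding leaf_martingale_eq_deviation[OF W] y_def[symmetric] by (simp add: abs_mult)
  then have "measure_pmf.prob (leaf_chain W m)
      {x. \<bar>real x - measure_pmf.expectation (leaf_chain W m) real\<bar> \<ge> r} \<le> 2 * exp (- 2 * (y * r)\<^sup>2 / sqsum W m)"
    using leaf_martingale_tail[OF W m, of "y * r"] r y by simp
  also have "\<dots> \<le> 2 * exp (- (6 * r\<^sup>2 / (y + 3)))"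
  proof -
    have "(3 * sqsum W m) * (2 * r\<^sup>2) \<le> ((y + 3) * y\<^sup>2) * (2 * r\<^sup>2)"
      by (rule mult_right_mono[OF *]) simp
    then have "6 * r\<^sup>2 / (y + 3) \<le> 2 * (y * r)\<^sup>2 / sqsum W m"
      using V y by (simp add: field_simps power_mult_distrib)
    then show ?thesis by simp
  qed
  also have "y + 3 = real m + 2 + W" by (simp add: y_def)
  finally show ?thesis .
qed

section \<open>Normal approximation of the characteristic function\<close>

text \<open>The lower estimate is the tangent of the exponential at 0. For the upper one, the gap
  \<open>g\<close> vanishes at 0 and has derivative exp (- y) - 1 + y \<ge> 0.\<close>

lemma exp_neg_approx:
  fixes x :: real
  assumes "x \<ge> 0"
  shows "\<bar>exp (- x) - (1 - x)\<bar> \<le> x\<^sup>2 / 2"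
proof -
  have 1: "1 - x \<le> exp (- x)" using exp_ge_add_one_self[of "-x"] by simp
  define g where "g x = 1 - x + x\<^sup>2 / 2 - exp (- x)" for x :: real
  have "g 0 \<le> g x"
  proof (rule DERIV_nonneg_imp_nondecreasing[OF assms])
    fix y :: real assume "0 \<le> y" "y \<le> x"
    have "(g has_real_derivative (- 1 + y + exp (- y))) (at y)"
      unfolding g_def by (auto intro!: derivative_eq_intros)
    moreover have "- 1 + y + exp (- y) \<ge> 0" using exp_ge_add_one_self[of "-y"] by simp
    ultimately show "\<exists>d. (g has_real_derivative d) (at y) \<and> 0 \<le> d" by blast
  qed
  with 1 show ?thesis by (simp add: g_def)
qed

text \<open>The second-order Taylor expansion costs |\<theta>|^3 / 6 and, as the mean is zero,
  leaves 1 - \<theta>^2 p (1 - p) / 2. Since p (1 - p) = 1 / 4 - (p - 1/2)^2, replacing the variance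
  by 1 / 4 gives a factor free of p at the cost of the last error term; the middle one comes from
  \<open>exp_neg_approx\<close>.\<close>

lemma bernoulli_char_approx:
  fixes p \<theta> :: real
  assumes p: "0 \<le> p" "p \<le> 1"
  shows "cmod (p * iexp (- \<theta> * (1 - p)) + (1 - p) * iexp (\<theta> * p) - exp (- \<theta>\<^sup>2 / 8))
    \<le> \<bar>\<theta>\<bar> ^ 3 / 6 + \<theta> ^ 4 / 128 + \<theta>\<^sup>2 * (p - 1/2)\<^sup>2 / 2"
proof -
  define T where "T x = (1 + \<i> * complex_of_real x - complex_of_real (x\<^sup>2 / 2))" for x
  have approx: "cmod (iexp x - T x) \<le> \<bar>x\<bar> ^ 3 / 6" for x
  proof -
    have "(\<Sum>k\<le>2. (\<i> * complex_of_real x) ^ k / fact k) = T x"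
      by (simp add: T_def eval_nat_numeral power_mult_distrib)
    moreover have "\<bar>x\<bar> ^ Suc 2 / fact (Suc 2) = \<bar>x\<bar> ^ 3 / 6"
      by (simp add: eval_nat_numeral)
    ultimately show ?thesis using iexp_approx1[of x 2] by (simp only:)
  qed
  let ?a = "- \<theta> * (1 - p)" and ?b = "\<theta> * p"
  have le\<theta>: "\<bar>?a\<bar> ^ 3 / 6 \<le> \<bar>\<theta>\<bar> ^ 3 / 6" "\<bar>?b\<bar> ^ 3 / 6 \<le> \<bar>\<theta>\<bar> ^ 3 / 6"
    using p by (auto intro!: divide_right_mono power_mono simp: abs_mult mult_left_le)
  have main: "complex_of_real p * T ?a + complex_of_real (1 - p) * T ?b = complex_of_real (1 - \<theta>\<^sup>2 * p * (1 - p) / 2)"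
    unfolding T_def by (simp add: power2_eq_square) (simp add: field_simps)
  have A: "cmod (complex_of_real p * (iexp ?a - T ?a) + complex_of_real (1 - p) * (iexp ?b - T ?b)) \<le> \<bar>\<theta>\<bar> ^ 3 / 6"
  proof -
    have "cmod (complex_of_real p * (iexp ?a - T ?a) + complex_of_real (1 - p) * (iexp ?b - T ?b)) \<le>
       p * cmod (iexp ?a - T ?a) + (1 - p) * cmod (iexp ?b - T ?b)"
    proof (rule order_trans[OF norm_triangle_ineq], rule eq_refl)
      have "\<bar>p\<bar> = p" "\<bar>1 - p\<bar> = 1 - p" using p by simp_all
      then show "cmod (complex_of_real p * (iexp ?a - T ?a)) + cmod (complex_of_real (1 - p) * (iexp ?b - T ?b)) =
          p * cmod (iexp ?a - T ?a) + (1 - p) * cmod (iexp ?b - T ?b)"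
        by (simp only: norm_mult norm_of_real)
    qed
    also have "\<dots> \<le> p * (\<bar>\<theta>\<bar> ^ 3 / 6) + (1 - p) * (\<bar>\<theta>\<bar> ^ 3 / 6)"
      using p by (intro add_mono mult_left_mono order_trans[OF approx] le\<theta>) auto
    also have "\<dots> = \<bar>\<theta>\<bar> ^ 3 / 6" by (simp only: distrib_right[symmetric]) simp
    finally show ?thesis .
  qed
  have B: "\<bar>(1 - \<theta>\<^sup>2 * p * (1 - p) / 2) - exp (- \<theta>\<^sup>2 / 8)\<bar> \<le> \<theta> ^ 4 / 128 + \<theta>\<^sup>2 * (p - 1/2)\<^sup>2 / 2"
  proof -
    have "(1 - \<theta>\<^sup>2 * p * (1 - p) / 2) - exp (- \<theta>\<^sup>2 / 8) =
        \<theta>\<^sup>2 * (p - 1/2)\<^sup>2 / 2 - (exp (- (\<theta>\<^sup>2 / 8)) - (1 - \<theta>\<^sup>2 / 8))"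
      by (simp add: power2_eq_square field_simps)
    moreover have "(\<theta>\<^sup>2 / 8)\<^sup>2 / 2 = \<theta> ^ 4 / 128"
      by (simp add: power2_eq_square power4_eq_xxxx)
    moreover have "\<theta>\<^sup>2 * (p - 1/2)\<^sup>2 / 2 \<ge> 0" by simp
    moreover have "\<bar>exp (- (\<theta>\<^sup>2 / 8)) - (1 - \<theta>\<^sup>2 / 8)\<bar> \<le> (\<theta>\<^sup>2 / 8)\<^sup>2 / 2"
      by (rule exp_neg_approx) simp
    ultimately show ?thesis by linarith
  qed
  have "complex_of_real p * iexp ?a + complex_of_real (1 - p) * iexp ?b - complex_of_real (exp (- \<theta>\<^sup>2 / 8)) =
     (complex_of_real p * (iexp ?a - T ?a) + complex_of_real (1 - p) * (iexp ?b - T ?b)) +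
     complex_of_real ((1 - \<theta>\<^sup>2 * p * (1 - p) / 2) - exp (- \<theta>\<^sup>2 / 8))"
  proof -
    have regroup: "a * b + c * d - e = (a * (b - b') + c * (d - d')) + ((a * b' + c * d') - e)"
      for a b b' c d d' e :: complex
      by (simp add: algebra_simps)
    show ?thesis
      by (simp only: of_real_diff[of "1 - \<theta>\<^sup>2 * p * (1 - p) / 2"] main[symmetric]) (rule regroup)
  qed
  also have "cmod \<dots> \<le> \<bar>\<theta>\<bar> ^ 3 / 6 + (\<theta> ^ 4 / 128 + \<theta>\<^sup>2 * (p - 1/2)\<^sup>2 / 2)"
    by (rule order_trans[OF norm_triangle_ineq add_mono[OF A]]) (use B in \<open>simp only: norm_of_real\<close>)
  finally show ?thesis by simp
qed

text \<open>Conditionally on the state, apply \<open>bernoulli_char_approx\<close> with \<theta> = u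
  s. As D = s (p - 1/2), its last error term becomes u^2 D^2 / 2, so the second moment of D controls
  the replacement of a random factor by a constant one.\<close>

lemma leaf_martingale_char_step:
  fixes u :: real and \<psi> :: "nat \<Rightarrow> complex"
  assumes W: "W > 0"
  defines "\<psi> \<equiv> \<lambda>m. measure_pmf.expectation (leaf_chain W m) (\<lambda>x. iexp (u * leaf_martingale W m x))"
  shows "cmod (\<psi> (Suc m) - exp (- u\<^sup>2 * (W + real m)\<^sup>2 / 8) * \<psi> m) \<le>
    \<bar>u\<bar> ^ 3 * (W + real m) ^ 3 / 6 + u ^ 4 * (W + real m) ^ 4 / 128 +
    u\<^sup>2 / 2 * measure_pmf.expectation (leaf_chain W m) (\<lambda>x. (centred W m x)\<^sup>2)"
proof -
  define s where "s = W + real m"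
  have s: "s > 0" using W by (simp add: s_def)
  define f where "f x = complex_of_real (real x / s) * iexp (- (u * s) * (1 - real x / s)) +
    complex_of_real (1 - real x / s) * iexp ((u * s) * (real x / s))" for x :: nat
  define q where "q = exp (- (u * s)\<^sup>2 / 8)"
  have "\<psi> (Suc m) = measure_pmf.expectation (leaf_chain W m) (\<lambda>x. iexp (u * leaf_martingale W m x) * f x)"
    unfolding \<psi>_def expectation_leaf_chain_Suc[OF W]
  proof (rule expectation_cong_pmf)
    fix x
    define p where "p = real x / (W + real m)"
    have iexp_add: "iexp (a + b) = iexp a * iexp b" for a b
      by (simp only: of_real_add distrib_left exp_add)
    have arg: "u * (leaf_martingale W m x - s * (1 - p)) = u * leaf_martingale W m x + (- (u * s) * (1 - p))"
      "u * (leaf_martingale W m x + s * p) = u * leaf_martingale W m x + (u * s) * p"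
      by (simp_all add: algebra_simps)
    show "p *\<^sub>R iexp (u * leaf_martingale W (Suc m) x) + (1 - p) *\<^sub>R iexp (u * leaf_martingale W (Suc m) (Suc x)) = iexp (u * leaf_martingale W m x) * f x"
      unfolding leaf_martingale_Suc[OF W, of m x] f_def s_def p_def[symmetric]
      unfolding s_def[symmetric] arg iexp_add scaleR_conv_of_real
      by (simp only: distrib_left mult.left_commute)
  qed
  moreover have q: "complex_of_real q * \<psi> m = measure_pmf.expectation (leaf_chain W m) (\<lambda>x. iexp (u * leaf_martingale W m x) * complex_of_real q)"
    unfolding \<psi>_def by (subst integral_mult_left_zero) (rule mult.commute)
  ultimately have diff: "\<psi> (Suc m) - complex_of_real q * \<psi> m =
      measure_pmf.expectation (leaf_chain W m) (\<lambda>x. iexp (u * leaf_martingale W m x) * f x - iexp (u * leaf_martingale W m x) * complex_of_real q)"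
    by (simp only: Bochner_Integration.integral_diff[OF integrable_leaf_chain integrable_leaf_chain])
  have "cmod (\<psi> (Suc m) - complex_of_real q * \<psi> m) \<le> measure_pmf.expectation (leaf_chain W m)
     (\<lambda>x. \<bar>u\<bar> ^ 3 * s ^ 3 / 6 + u ^ 4 * s ^ 4 / 128 + u\<^sup>2 / 2 * (centred W m x)\<^sup>2)"
    unfolding diff
  proof (rule norm_expectation_le)
    fix x assume x: "x \<in> set_pmf (leaf_chain W m)"
    define p where "p = real x / s"
    have p: "0 \<le> p" "p \<le> 1" using leaf_chain_prob_bounds[OF W x] by (auto simp: p_def s_def)
    have c: "centred W m x = s * (p - 1/2)" using s by (simp add: centred_def p_def s_def[symmetric] field_simps)
    have "cmod (iexp (u * leaf_martingale W m x) * f x - iexp (u * leaf_martingale W m x) * complex_of_real q) = cmod (f x - complex_of_real q)"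
      unfolding right_diff_distrib[symmetric] norm_mult by simp
    also have "\<dots> \<le> \<bar>u * s\<bar> ^ 3 / 6 + (u * s) ^ 4 / 128 + (u * s)\<^sup>2 * (p - 1/2)\<^sup>2 / 2"
      unfolding f_def q_def p_def[symmetric] by (rule bernoulli_char_approx[OF p])
    also have "\<dots> = \<bar>u\<bar> ^ 3 * s ^ 3 / 6 + u ^ 4 * s ^ 4 / 128 + u\<^sup>2 / 2 * (centred W m x)\<^sup>2"
      unfolding c using s by (simp add: abs_mult power_mult_distrib)
    finally show "cmod (iexp (u * leaf_martingale W m x) * f x - iexp (u * leaf_martingale W m x) * complex_of_real q) \<le>
      \<bar>u\<bar> ^ 3 * s ^ 3 / 6 + u ^ 4 * s ^ 4 / 128 + u\<^sup>2 / 2 * (centred W m x)\<^sup>2" .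
  qed simp
  also have "\<dots> = \<bar>u\<bar> ^ 3 * s ^ 3 / 6 + u ^ 4 * s ^ 4 / 128 +
    u\<^sup>2 / 2 * measure_pmf.expectation (leaf_chain W m) (\<lambda>x. (centred W m x)\<^sup>2)"
    by (rule expectation_affine) simp
  finally have "cmod (\<psi> (Suc m) - complex_of_real q * \<psi> m) \<le> \<bar>u\<bar> ^ 3 * s ^ 3 / 6 + u ^ 4 * s ^ 4 / 128 +
    u\<^sup>2 / 2 * measure_pmf.expectation (leaf_chain W m) (\<lambda>x. (centred W m x)\<^sup>2)" .
  moreover have "q = exp (- u\<^sup>2 * (W + real m)\<^sup>2 / 8)"
    by (simp add: q_def s_def power_mult_distrib)
  ultimately show ?thesis unfolding s_def by (simp only:)
qed

text \<open>The Gaussian factors are at most 1, so the one-step errors simply add up. There are at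
  most S steps, and each error is at most its bound \<open>E\<close> at the final total weight
  \<open>S\<close>.\<close>

lemma leaf_martingale_char_approx:
  fixes u :: real
  assumes W: "W > 0" and K: "\<And>m. measure_pmf.expectation (leaf_chain W m) (\<lambda>x. (centred W m x)\<^sup>2) \<le> K + (W + real m) / 12"
    and m: "m \<ge> 1"
  defines "S \<equiv> W + real m"
  shows "cmod (measure_pmf.expectation (leaf_chain W m) (\<lambda>x. iexp (u * leaf_martingale W m x)) - exp (- u\<^sup>2 * sqsum W m / 8)) \<le>
     S * (\<bar>u\<bar> ^ 3 * S ^ 3 / 6 + u ^ 4 * S ^ 4 / 128 + u\<^sup>2 / 2 * (K + S / 12))"
proof -
  define E where "E = \<bar>u\<bar> ^ 3 * S ^ 3 / 6 + u ^ 4 * S ^ 4 / 128 + u\<^sup>2 / 2 * (K + S / 12)"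
  define \<psi> where "\<psi> j = measure_pmf.expectation (leaf_chain W j) (\<lambda>x. iexp (u * leaf_martingale W j x))" for j
  have S: "S > 0" using W by (simp add: S_def)
  \<comment> \<open>As an upper bound of a second moment, \<open>K + S / 12\<close> is nonnegative,
    which gives \<open>E \<ge> 0\<close>.\<close>
  have "0 \<le> measure_pmf.expectation (leaf_chain W m) (\<lambda>x. (centred W m x)\<^sup>2)" by simp
  also note K[of m]
  finally have E: "E \<ge> 0" unfolding E_def S_def[symmetric] using S by simp
  have "j \<le> m \<longrightarrow> cmod (\<psi> j - exp (- u\<^sup>2 * sqsum W j / 8)) \<le> real j * E" if "j \<ge> 1" for j
    using that
  proof (induction j rule: dec_induct)
    case base
    show ?case using E by (simp add: \<psi>_def sqsum_def expectation_leaf_chain_1[OF W] del: leaf_chain.simps)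
  next
    case (step j)
    show ?case
    proof
      assume j: "Suc j \<le> m"
      define s where "s = W + real j"
      define q where "q = exp (- u\<^sup>2 * s\<^sup>2 / 8)"
      have s: "0 \<le> s" "s \<le> S" using j W by (auto simp: s_def S_def)
      have q: "0 \<le> q" "q \<le> 1" by (auto simp: q_def)
      have "cmod (\<psi> (Suc j) - q * \<psi> j) \<le> \<bar>u\<bar> ^ 3 * s ^ 3 / 6 + u ^ 4 * s ^ 4 / 128 +
          u\<^sup>2 / 2 * measure_pmf.expectation (leaf_chain W j) (\<lambda>x. (centred W j x)\<^sup>2)"
        unfolding q_def \<psi>_def s_def by (rule leaf_martingale_char_step[OF W])
      also have "\<dots> \<le> E" unfolding E_def
      proof (intro add_mono divide_right_mono mult_left_mono power_mono)
        show "measure_pmf.expectation (leaf_chain W j) (\<lambda>x. (centred W j x)\<^sup>2) \<le> K + S / 12"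
          using K[of j] s(2) unfolding s_def[symmetric] by linarith
      qed (use s in simp_all)
      finally have 1: "cmod (\<psi> (Suc j) - q * \<psi> j) \<le> E" .
      have "cmod (q * (\<psi> j - exp (- u\<^sup>2 * sqsum W j / 8))) \<le> 1 * (real j * E)"
        unfolding norm_mult
      proof (rule mult_mono)
        show "cmod (complex_of_real q) \<le> 1" using q by simp
        show "cmod (\<psi> j - exp (- u\<^sup>2 * sqsum W j / 8)) \<le> real j * E"
          using step.IH j by linarith
      qed simp_all
      then have 2: "cmod (q * (\<psi> j - exp (- u\<^sup>2 * sqsum W j / 8))) \<le> real j * E" by simp
      have "exp (- u\<^sup>2 * sqsum W (Suc j) / 8) = q * exp (- u\<^sup>2 * sqsum W j / 8)"
        unfolding q_def exp_add[symmetric] sqsum_Suc[OF step.hyps(1)] s_def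
        by (simp add: distrib_left add_divide_distrib add.commute)
      moreover have telescope: "a - c * d = (a - c * b) + c * (b - d)" for a b c d :: complex
        by (simp add: algebra_simps)
      ultimately have "\<psi> (Suc j) - exp (- u\<^sup>2 * sqsum W (Suc j) / 8) =
          (\<psi> (Suc j) - q * \<psi> j) + q * (\<psi> j - exp (- u\<^sup>2 * sqsum W j / 8))"
        by (simp only: of_real_mult)
      also have "cmod \<dots> \<le> E + real j * E"
        by (rule order_trans[OF norm_triangle_ineq add_mono[OF 1 2]])
      finally show "cmod (\<psi> (Suc j) - exp (- u\<^sup>2 * sqsum W (Suc j) / 8)) \<le> real (Suc j) * E"
        by (simp add: algebra_simps)
    qed
  qed
  from this[OF m] have "cmod (\<psi> m - exp (- u\<^sup>2 * sqsum W m / 8)) \<le> real m * E" by simp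
  also have "\<dots> \<le> S * E" using E W by (intro mult_right_mono) (auto simp: S_def)
  finally show ?thesis unfolding \<psi>_def E_def .
qed

text \<open>With u of order at most n^(-3/2) and S of order n, the three terms are of order at most
  n^(-1/2), 1 / n and 1 / n.\<close>

lemma tendsto_char_error:
  fixes S u V :: "nat \<Rightarrow> real"
  assumes S: "(\<lambda>n. S n / real n) \<longlonglongrightarrow> 1"
    and z: "(\<lambda>n. (u n)\<^sup>2 * real n ^ 3) \<longlonglongrightarrow> a"
    and pos: "eventually (\<lambda>n. S n \<ge> 0) sequentially"
  shows "(\<lambda>n. S n * (\<bar>u n\<bar> ^ 3 * S n ^ 3 / 6 + u n ^ 4 * S n ^ 4 / 128 + (u n)\<^sup>2 / 2 * (K + S n / 12))) \<longlonglongrightarrow> 0"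
proof -
  let ?z = "\<lambda>n. (u n)\<^sup>2 * real n ^ 3" and ?s = "\<lambda>n. S n / real n" and ?i = "\<lambda>n. 1 / real n"
  have i: "?i \<longlonglongrightarrow> 0" by (rule lim_1_over_n)
  \<comment> \<open>The error is rewritten in the convergent quantities u^2 n^3, S / n and 1 / n.
    The root appears because |u|^3 is an odd power, while only u^2 is controlled.\<close>
  have "(\<lambda>n. sqrt (?z n ^ 3 * ?s n ^ 8 * ?i n) / 6 + ?z n ^ 2 * ?s n ^ 5 * ?i n / 128 + ?z n / 2 * ?s n * (K * ?i n + ?s n / 12) * ?i n)
     \<longlonglongrightarrow> sqrt (a ^ 3 * 1 ^ 8 * 0) / 6 + a ^ 2 * 1 ^ 5 * 0 / 128 + a / 2 * 1 * (K * 0 + 1 / 12) * 0"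
    by (intro tendsto_intros S z i) auto
  moreover have "eventually (\<lambda>n. sqrt (?z n ^ 3 * ?s n ^ 8 * ?i n) / 6 + ?z n ^ 2 * ?s n ^ 5 * ?i n / 128 + ?z n / 2 * ?s n * (K * ?i n + ?s n / 12) * ?i n
     = S n * (\<bar>u n\<bar> ^ 3 * S n ^ 3 / 6 + u n ^ 4 * S n ^ 4 / 128 + (u n)\<^sup>2 / 2 * (K + S n / 12))) sequentially"
    using pos eventually_gt_at_top[of 0]
  proof eventually_elim
    case (elim n)
    have n: "real n > 0" using elim by simp
    have "?z n ^ 3 * ?s n ^ 8 * ?i n = (\<bar>u n\<bar> ^ 3 * S n ^ 4)\<^sup>2"
    proof -
      have "(\<bar>u n\<bar> ^ 3)\<^sup>2 = ((u n)\<^sup>2) ^ 3"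
        by (simp only: power_mult[symmetric] mult.commute[of 3]) (simp only: power_mult power2_abs)
      then show ?thesis using n by (simp add: power_mult_distrib power_divide power_mult[symmetric]) (simp add: field_simps eval_nat_numeral)
    qed
    then have 1: "sqrt (?z n ^ 3 * ?s n ^ 8 * ?i n) = \<bar>u n\<bar> ^ 3 * S n ^ 4"
      using elim by (simp only: real_sqrt_abs) (simp add: abs_mult)
    have 2: "?z n ^ 2 * ?s n ^ 5 * ?i n = u n ^ 4 * S n ^ 5"
      using n by (simp add: power_mult_distrib power_divide power_mult[symmetric]) (simp add: field_simps eval_nat_numeral)
    have 3: "?z n / 2 * ?s n * (K * ?i n + ?s n / 12) * ?i n = (u n)\<^sup>2 / 2 * S n * (K + S n / 12)"
      using n by (simp add: field_simps power3_eq_cube)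
    show ?case unfolding 1 2 3 by (simp add: algebra_simps eval_nat_numeral)
  qed
  ultimately show ?thesis by (auto intro: Lim_transform_eventually)
qed

lemma norm_iexp_diff_le: "cmod (iexp a - iexp b) \<le> \<bar>a - b\<bar>"
proof -
  have "iexp a - iexp b = iexp b * (iexp (a - b) - 1)"
    by (simp only: of_real_diff right_diff_distrib exp_diff) simp
  then have "cmod (iexp a - iexp b) = cmod (iexp (a - b) - 1)"
    by (simp only: norm_mult norm_exp_i_times mult_1)
  then show ?thesis using iexp_approx1[of "a - b" 0] by simp
qed

section \<open>Leaves of the weighted recursive tree\<close>

lemma wrt_Suc:
  assumes "n \<ge> 1"
  shows "wrt w (Suc n) =
    bind_pmf (wrt w n) (\<lambda>T. map_pmf (\<lambda>i. T(Suc n := i)) (attach_pmf w n))"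
  using assms by (cases n) (simp_all add: map_pmf_def)

locale eventually_unit_weights =
  fixes w :: "nat \<Rightarrow> real" and k :: nat
  assumes w_pos: "\<And>i. i \<ge> 1 \<Longrightarrow> w i > 0"
    and k: "k \<ge> 1"
    and w_unit: "\<And>i. i > k \<Longrightarrow> w i = 1"
begin

abbreviation W :: real where "W \<equiv> \<Sum>l=1..k. w l"

lemma pmf_attach_pmf_pos:
  assumes "n \<ge> 1"
  shows "pmf (attach_pmf w n) i = (if 1 \<le> i \<and> i \<le> n then w i / (\<Sum>l=1..n. w l) else 0)"
  using pmf_attach_pmf[OF assms, of w i] w_pos by simp

lemma set_attach_pmf:
  assumes "n \<ge> 1"
  shows "set_pmf (attach_pmf w n) = {1..n}"
proof -
  have "(\<Sum>l=1..n. w l) > 0"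
    using assms w_pos by (intro sum_pos) auto
  then show ?thesis
    using w_pos by (auto simp: set_eq_iff set_pmf_iff pmf_attach_pmf_pos[OF assms] less_imp_neq[symmetric])
qed

lemma finite_wrt: "finite (set_pmf (wrt w n))"
proof (induction n)
  case (Suc n)
  then show ?case by (cases "n = 0") (simp_all add: wrt_Suc set_attach_pmf)
qed simp

lemma integrable_wrt [simp]:
  fixes f :: "(nat \<Rightarrow> nat) \<Rightarrow> 'b::{banach, second_countable_topology}"
  shows "integrable (measure_pmf (wrt w n)) f"
  by (simp add: integrable_measure_pmf_finite finite_wrt)

lemma wrt_support:
  assumes "T \<in> set_pmf (wrt w n)"
  shows "T (Suc 0) = 0 \<and> (\<forall>u\<in>{2..n}. 1 \<le> T u \<and> T u < u)"
  using assms
proof (induction n arbitrary: T)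
  case (Suc n)
  show ?case
  proof (cases "n = 0")
    case False
    with Suc.prems obtain T' i where T: "T' \<in> set_pmf (wrt w n)" "i \<in> {1..n}" "T = T'(Suc n := i)"
      by (auto simp: wrt_Suc set_attach_pmf)
    with Suc.IH[OF T(1)] False show ?thesis by auto
  qed (use Suc.prems in auto)
qed simp

text \<open>The root is included, since its default parent is 0.\<close>

lemma wrt_parent_less:
  assumes "T \<in> set_pmf (wrt w n)" "u \<in> {1..n}"
  shows "T u < u"
  using wrt_support[OF assms(1)] assms(2) by (cases "u = 1") auto

lemma expectation_wrt_Suc:
  fixes h :: "(nat \<Rightarrow> nat) \<Rightarrow> 'b::{banach, second_countable_topology}"
  assumes n: "n \<ge> 1"
  shows "measure_pmf.expectation (wrt w (Suc n)) h = measure_pmf.expectation (wrt w n)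
    (\<lambda>T. \<Sum>i=1..n. (w i / (\<Sum>l=1..n. w l)) *\<^sub>R h (T(Suc n := i)))"
  unfolding wrt_Suc[OF n]
proof (subst expectation_bind_finite; (intro expectation_cong_pmf)?)
  fix T
  show "measure_pmf.expectation (map_pmf (\<lambda>i. T(Suc n := i)) (attach_pmf w n)) h =
      (\<Sum>i=1..n. (w i / (\<Sum>l=1..n. w l)) *\<^sub>R h (T(Suc n := i)))"
    by (subst integral_map_pmf, subst integral_measure_pmf[of "{1..n}"])
      (auto simp: set_attach_pmf[OF n] pmf_attach_pmf_pos[OF n] intro!: sum.cong)
qed (use n in \<open>auto simp: finite_wrt set_attach_pmf\<close>)

text \<open>Parents are smaller than their children, so the new node has no child yet, and among the
  old nodes only its parent \<open>i\<close> can change its status.\<close>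

lemma leaves_Suc:
  assumes "T \<in> set_pmf (wrt w n)" "i \<in> {1..n}"
  shows "leaves (Suc n) (T(Suc n := i)) = insert (Suc n) (leaves n T - {i})"
proof -
  have "T u \<noteq> Suc n" if "u \<in> {1..n}" for u
    using wrt_parent_less[OF assms(1) that] that by auto
  then show ?thesis
    using assms(2) unfolding leaves_def by (auto simp: le_Suc_eq)
qed

lemma finite_leaves [simp]: "finite (leaves n T)"
  by (simp add: leaves_def)

text \<open>Unit weights make the probability of hitting \<open>A\<close> depend on its cardinality
  alone. This is what makes the number of late leaves a Markov chain.\<close>

lemma map_attach_pmf_mem:
  assumes n: "n \<ge> 1" and A: "A \<subseteq> {1..n}" "\<And>i. i \<in> A \<Longrightarrow> w i = 1"
  shows "map_pmf (\<lambda>i. i \<in> A) (attach_pmf w n) = bernoulli_pmf (real (card A) / (\<Sum>l=1..n. w l))"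
proof -
  let ?S = "\<Sum>l=1..n. w l"
  have S: "?S > 0" using n w_pos by (intro sum_pos) auto
  have fin: "finite A" using A(1) finite_subset by blast
  have "measure_pmf.prob (attach_pmf w n) A = (\<Sum>i\<in>A. pmf (attach_pmf w n) i)"
    using fin by (rule measure_measure_pmf_finite)
  also have "\<dots> = (\<Sum>i\<in>A. 1 / ?S)"
    using A by (intro sum.cong refl) (auto simp: pmf_attach_pmf_pos[OF n])
  finally have p: "measure_pmf.prob (attach_pmf w n) A = real (card A) / ?S" by simp
  have "real (card A) / ?S \<le> 1" "0 \<le> real (card A) / ?S"
    unfolding p[symmetric] by auto
  moreover have "pmf (map_pmf (\<lambda>i. i \<in> A) (attach_pmf w n)) True = real (card A) / ?S"
    unfolding p[symmetric] by (simp add: pmf_map vimage_def)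
  ultimately have "pmf (map_pmf (\<lambda>i. i \<in> A) (attach_pmf w n)) b = pmf (bernoulli_pmf (real (card A) / ?S)) b" for b
    by (cases b) (simp_all add: pmf_False_conv_True)
  then show ?thesis by (rule pmf_eqI)
qed

section \<open>Splitting the leaves at node \<open>k\<close>\<close>

definition late_leaves :: "nat \<Rightarrow> (nat \<Rightarrow> nat) \<Rightarrow> nat" where
  "late_leaves n T = card (leaves n T \<inter> {k<..})"

definition early_leaves :: "nat \<Rightarrow> (nat \<Rightarrow> nat) \<Rightarrow> nat" where
  "early_leaves n T = card (leaves n T \<inter> {..k})"

lemma sum_weights: "(\<Sum>l=1..k + m. w l) = W + real m"
  by (induction m) (use w_unit k in auto)

lemma sum_weights_pos: "W > 0"
  using w_pos k by (intro sum_pos) auto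

lemma num_leaves_split: "num_leaves n T = real (late_leaves n T) + real (early_leaves n T)"
proof -
  have "leaves n T = (leaves n T \<inter> {k<..}) \<union> (leaves n T \<inter> {..k})" by auto
  moreover have "card ((leaves n T \<inter> {k<..}) \<union> (leaves n T \<inter> {..k})) = late_leaves n T + early_leaves n T"
    unfolding late_leaves_def early_leaves_def
    by (subst card_Un_disjoint[symmetric]) auto
  ultimately show ?thesis by (simp add: num_leaves_def)
qed

text \<open>The new node, late because \<open>n \<ge> k\<close>, adds one leaf; its parent leaves
  the count exactly if it was a late leaf.\<close>

lemma late_leaves_Suc:
  assumes "T \<in> set_pmf (wrt w n)" "i \<in> {1..n}" "n \<ge> k"
  shows "late_leaves (Suc n) (T(Suc n := i)) =
    (if i \<in> leaves n T \<inter> {k<..} then late_leaves n T else Suc (late_leaves n T))"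
proof -
  let ?A = "leaves n T \<inter> {k<..}"
  have "leaves (Suc n) (T(Suc n := i)) \<inter> {k<..} = insert (Suc n) (?A - {i})"
    using assms unfolding leaves_Suc[OF assms(1,2)] by auto
  moreover have "card (insert (Suc n) (?A - {i})) = Suc (card (?A - {i}))"
    by (rule card_insert_disjoint) (auto simp: leaves_def)
  ultimately have "late_leaves (Suc n) (T(Suc n := i)) = Suc (card (?A - {i}))"
    unfolding late_leaves_def by simp
  moreover have "card ?A = Suc (card (?A - {i}))" if "i \<in> ?A"
    using that by (intro card.remove) auto
  ultimately show ?thesis unfolding late_leaves_def by auto
qed

text \<open>Given the tree, the law of the next count depends on the tree only through the present
  count, so the recursion closes. At \<open>m = 0\<close> there are no late nodes.\<close>

lemma map_late_leaves:
  "map_pmf (late_leaves (k + m)) (wrt w (k + m)) = leaf_chain W m"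
proof (induction m)
  case 0
  have "late_leaves k T = 0" for T
    unfolding late_leaves_def leaves_def by (auto simp: card_eq_0_iff)
  then show ?case by (simp add: map_pmf_const)
next
  case (Suc m)
  let ?n = "k + m"
  have n: "?n \<ge> 1" using k by simp
  have "map_pmf (late_leaves (Suc ?n)) (wrt w (Suc ?n)) = bind_pmf (wrt w ?n)
      (\<lambda>T. map_pmf (\<lambda>i. late_leaves (Suc ?n) (T(Suc ?n := i))) (attach_pmf w ?n))"
    unfolding wrt_Suc[OF n] by (simp add: map_bind_pmf pmf.map_comp o_def)
  also have "\<dots> = bind_pmf (wrt w ?n) (\<lambda>T. map_pmf (\<lambda>b. if b then late_leaves ?n T else Suc (late_leaves ?n T))
      (bernoulli_pmf (real (late_leaves ?n T) / (W + real m))))"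
  proof (rule bind_pmf_cong[OF refl])
    fix T assume T: "T \<in> set_pmf (wrt w ?n)"
    let ?A = "leaves ?n T \<inter> {k<..}"
    have "map_pmf (\<lambda>i. late_leaves (Suc ?n) (T(Suc ?n := i))) (attach_pmf w ?n) =
        map_pmf (\<lambda>i. if i \<in> ?A then late_leaves ?n T else Suc (late_leaves ?n T)) (attach_pmf w ?n)"
      using late_leaves_Suc[OF T] n by (intro map_pmf_cong refl) (simp add: set_attach_pmf)
    also have "\<dots> = map_pmf (\<lambda>b. if b then late_leaves ?n T else Suc (late_leaves ?n T)) (map_pmf (\<lambda>i. i \<in> ?A) (attach_pmf w ?n))"
      by (simp add: pmf.map_comp o_def)
    also have "map_pmf (\<lambda>i. i \<in> ?A) (attach_pmf w ?n) = bernoulli_pmf (real (card ?A) / (\<Sum>l=1..?n. w l))"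
      using w_unit by (intro map_attach_pmf_mem n) (auto simp: leaves_def)
    finally show "map_pmf (\<lambda>i. late_leaves (Suc ?n) (T(Suc ?n := i))) (attach_pmf w ?n) =
      map_pmf (\<lambda>b. if b then late_leaves ?n T else Suc (late_leaves ?n T))
      (bernoulli_pmf (real (late_leaves ?n T) / (W + real m)))"
      unfolding late_leaves_def[symmetric] sum_weights .
  qed
  also have "\<dots> = leaf_chain W (Suc m)"
    unfolding leaf_chain.simps Suc[symmetric] bind_map_pmf ..
  finally show ?case by simp
qed

lemma expectation_late_leaves:
  fixes g :: "nat \<Rightarrow> 'b::{banach, second_countable_topology}"
  shows "measure_pmf.expectation (wrt w (k + m)) (\<lambda>T. g (late_leaves (k + m) T)) =
    measure_pmf.expectation (leaf_chain W m) g"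
  unfolding map_late_leaves[symmetric] by simp

section \<open>Early leaves and their survival probabilities\<close>

lemma early_leaves_eq:
  assumes T: "T \<in> set_pmf (wrt w n)" and n: "n > k"
  shows "leaves n T \<inter> {..k} = {i \<in> {2..k}. i \<in> leaves n T}"
proof -
  \<comment> \<open>Node 2 exists because \<open>n > k\<close> and \<open>k \<ge> 1\<close>, and its
    only possible parent is node 1. So the root is not a leaf, which leaves at most k - 1 early
    leaves.\<close>
  have "1 \<le> T 2 \<and> T 2 < 2" using wrt_support[OF T] n k by simp
  then have "T 2 = 1" by simp
  then have "Suc 0 \<notin> leaves n T"
    using n k unfolding leaves_def by (auto intro!: bexI[of _ 2])
  moreover have "i \<ge> 2" if "i \<in> leaves n T" "i \<noteq> Suc 0" for i
    using that by (auto simp: leaves_def)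
  ultimately show ?thesis by auto
qed

lemma early_leaves_le:
  assumes T: "T \<in> set_pmf (wrt w n)" and n: "n > k"
  shows "real (early_leaves n T) \<le> real k - 1"
proof -
  have "early_leaves n T \<le> card {2..k}"
    unfolding early_leaves_def early_leaves_eq[OF assms] by (intro card_mono) auto
  then show ?thesis using k by simp
qed

text \<open>An old leaf remains a leaf exactly if the new node is not attached to it.\<close>

lemma prob_leaf_Suc:
  assumes n: "n \<ge> 1" and i: "i \<in> {1..n}"
  shows "measure_pmf.expectation (wrt w (Suc n)) (\<lambda>T. of_bool (i \<in> leaves (Suc n) T) :: real) =
    (1 - w i / (\<Sum>l=1..n. w l)) * measure_pmf.expectation (wrt w n) (\<lambda>T. of_bool (i \<in> leaves n T))"
proof -
  let ?S = "\<Sum>l=1..n. w l"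
  have S: "?S > 0" using n w_pos by (intro sum_pos) auto
  have "(\<Sum>j=1..n. (w j / ?S) *\<^sub>R of_bool (i \<in> leaves (Suc n) (T(Suc n := j))) :: real) =
      (1 - w i / ?S) * of_bool (i \<in> leaves n T)" if T: "T \<in> set_pmf (wrt w n)" for T
  proof -
    have "(\<Sum>j=1..n. (w j / ?S) *\<^sub>R of_bool (i \<in> leaves (Suc n) (T(Suc n := j))) :: real) =
        (\<Sum>j=1..n. (w j / ?S) * of_bool (i \<in> leaves n T) - (if j = i then (w j / ?S) * of_bool (i \<in> leaves n T) else 0))"
      using i by (intro sum.cong refl) (auto simp: leaves_Suc[OF T])
    also have "\<dots> = (\<Sum>j=1..n. w j / ?S) * of_bool (i \<in> leaves n T) - w i / ?S * of_bool (i \<in> leaves n T)"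
      unfolding sum_subtractf sum_distrib_right[symmetric] using i by simp
    also have "(\<Sum>j=1..n. w j / ?S) = 1"
      using S by (simp add: sum_divide_distrib[symmetric])
    finally show ?thesis by (simp only: left_diff_distrib)
  qed
  then show ?thesis
    unfolding expectation_wrt_Suc[OF n] by (subst expectation_cong_pmf) auto
qed

text \<open>Each survival factor satisfies 1 - w i / s \<le> ((s + 1) / s) powr (- w i), because ln
  (1 + 1 / s) \<le> 1 / s; the product of these bounds telescopes.\<close>

lemma prob_leaf_le:
  assumes i: "i \<in> {1..k}"
  shows "measure_pmf.expectation (wrt w (k + m)) (\<lambda>T. of_bool (i \<in> leaves (k + m) T) :: real) \<le>
    ((W + real m) / W) powr (- w i)"
proof (induction m)
  case 0
  have "measure_pmf.expectation (wrt w k) (\<lambda>T. of_bool (i \<in> leaves k T) :: real) \<le> measure_pmf.expectation (wrt w k) (\<lambda>_. 1)"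
    by (rule expectation_mono_pmf) (auto simp: finite_wrt)
  then show ?case using sum_weights_pos by simp
next
  case (Suc m)
  define s where "s = W + real m"
  have W: "W > 0" by (rule sum_weights_pos)
  then have s: "s > 0" by (simp add: s_def)
  have wi: "w i > 0" using i w_pos by simp
  have "ln (1 + 1 / s) \<le> 1 / s" using s by (intro ln_add_one_self_le_self) simp
  then have "1 - w i / s \<le> 1 + (- w i * ln (1 + 1 / s))"
    using wi mult_left_mono[of "ln (1 + 1 / s)" "1 / s" "w i"] by simp
  also have "\<dots> \<le> exp (- w i * ln (1 + 1 / s))" by (rule exp_ge_add_one_self)
  also have "\<dots> = (1 + 1 / s) powr (- w i)"
  proof -
    have "1 + 1 / s > 0" using s by (simp add: add_pos_pos)
    then show ?thesis by (simp add: powr_def)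
  qed
  finally have le: "1 - w i / s \<le> (1 + 1 / s) powr (- w i)" .
  have "measure_pmf.expectation (wrt w (k + Suc m)) (\<lambda>T. of_bool (i \<in> leaves (k + Suc m) T) :: real) =
     (1 - w i / s) * measure_pmf.expectation (wrt w (k + m)) (\<lambda>T. of_bool (i \<in> leaves (k + m) T))"
    using prob_leaf_Suc[of "k + m" i] i k unfolding sum_weights s_def by simp
  also have "\<dots> \<le> (1 + 1 / s) powr (- w i) * measure_pmf.expectation (wrt w (k + m)) (\<lambda>T. of_bool (i \<in> leaves (k + m) T))"
    by (rule mult_right_mono[OF le]) simp
  also have "\<dots> \<le> (1 + 1 / s) powr (- w i) * (s / W) powr (- w i)"
    using Suc by (intro mult_left_mono) (simp_all add: s_def)
  also have "\<dots> = ((s + 1) / W) powr (- w i)"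
  proof -
    have "(1 + 1 / s) * (s / W) = (s + 1) / W" using s W by (simp add: field_simps)
    moreover have "((1 + 1 / s) * (s / W)) powr (- w i) = (1 + 1 / s) powr (- w i) * (s / W) powr (- w i)"
      by (rule powr_mult)
    ultimately show ?thesis by (simp only:)
  qed
  finally show ?case by (simp add: s_def add_ac)
qed

section \<open>Mean and variance of the number of leaves\<close>

lemma mean_split:
  "leaves_mean w (k + m) = measure_pmf.expectation (leaf_chain W m) real +
    measure_pmf.expectation (wrt w (k + m)) (\<lambda>T. real (early_leaves (k + m) T))"
  unfolding num_leaves_split expectation_late_leaves[of m real, symmetric]
  by (rule Bochner_Integration.integral_add) simp_all

lemma expectation_early_leaves:
  assumes "n > k"
  shows "measure_pmf.expectation (wrt w n) (\<lambda>T. real (early_leaves n T)) =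
    (\<Sum>i=2..k. measure_pmf.expectation (wrt w n) (\<lambda>T. of_bool (i \<in> leaves n T)))"
proof -
  have "measure_pmf.expectation (wrt w n) (\<lambda>T. real (early_leaves n T)) =
      measure_pmf.expectation (wrt w n) (\<lambda>T. \<Sum>i=2..k. of_bool (i \<in> leaves n T))"
  proof (rule expectation_cong_pmf)
    fix T assume T: "T \<in> set_pmf (wrt w n)"
    show "real (early_leaves n T) = (\<Sum>i=2..k. of_bool (i \<in> leaves n T))"
      unfolding early_leaves_def early_leaves_eq[OF T assms]
      by (simp add: of_bool_def sum.If_cases Int_def)
  qed
  also have "\<dots> = (\<Sum>i=2..k. measure_pmf.expectation (wrt w n) (\<lambda>T. of_bool (i \<in> leaves n T)))"
    by (rule Bochner_Integration.integral_sum) simp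
  finally show ?thesis .
qed

text \<open>For n = k + m the main term (W + m) / 2 equals n / 2 + (W - k) / 2. What remains is the
  correction in \<open>expectation_leaf_chain\<close> and the mean number of early leaves.\<close>

lemma mean_bound:
  "\<exists>K\<ge>0. \<forall>n\<ge>2 * k + 2. \<bar>leaves_mean w n - (real n / 2 + (W - real k) / 2)\<bar> \<le>
    K * (1 / real n + (\<Sum>i=2..k. real n powr (- w i)))"
proof -
  \<comment> \<open>Dominates the constants (2 W) powr w i that arise when (W + m) / W is replaced
    by n / (2 W).\<close>
  define K1 where "K1 = (\<Sum>i=2..k. (2 * W) powr w i)"
  have K1: "K1 \<ge> 0" unfolding K1_def by (intro sum_nonneg) auto
  have W: "W > 0" by (rule sum_weights_pos)
  define K where "K = \<bar>W * (1 - W)\<bar> + K1"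
  have "\<bar>leaves_mean w n - (real n / 2 + (W - real k) / 2)\<bar> \<le>
    K * (1 / real n + (\<Sum>i=2..k. real n powr (- w i)))" if n: "n \<ge> 2 * k + 2" for n
  proof -
    define m where "m = n - k"
    have nm: "n = k + m" and m: "m \<ge> 1" using n k by (auto simp: m_def)
    \<comment> \<open>The threshold 2 k + 2 for n gives m - 1 \<ge> n / 2, which makes the
      denominators of both error terms comparable to n.\<close>
    have half: "W + real m - 1 \<ge> real n / 2" and n0: "real n > 0"
      using n W k by (auto simp: m_def of_nat_diff)
    let ?r = "measure_pmf.expectation (wrt w n) (\<lambda>T. real (early_leaves n T))"
    have "leaves_mean w n - (real n / 2 + (W - real k) / 2) = W * (1 - W) / (2 * (W + real m - 1)) + ?r"
      unfolding nm mean_split expectation_leaf_chain[OF W m] by (simp add: field_simps)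
    moreover have "\<bar>W * (1 - W) / (2 * (W + real m - 1))\<bar> \<le> \<bar>W * (1 - W)\<bar> * (1 / real n)"
    proof -
      have "\<bar>W * (1 - W) / (2 * (W + real m - 1))\<bar> = \<bar>W * (1 - W)\<bar> / (2 * (W + real m - 1))"
        using half n0 by (simp add: abs_divide)
      also have "\<dots> \<le> \<bar>W * (1 - W)\<bar> / real n"
        using half n0 by (intro divide_left_mono) auto
      finally show ?thesis by simp
    qed
    moreover have "0 \<le> ?r" by simp
    moreover have "?r \<le> K1 * (\<Sum>i=2..k. real n powr (- w i))"
    proof -
      have "?r = (\<Sum>i=2..k. measure_pmf.expectation (wrt w n) (\<lambda>T. of_bool (i \<in> leaves n T)))"
        using m unfolding nm by (intro expectation_early_leaves) simp
      also have "\<dots> \<le> (\<Sum>i=2..k. K1 * real n powr (- w i))"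
      proof (rule sum_mono)
        fix i assume i: "i \<in> {2..k}"
        have "measure_pmf.expectation (wrt w n) (\<lambda>T. of_bool (i \<in> leaves n T)) \<le> ((W + real m) / W) powr (- w i)"
          unfolding nm using i by (intro prob_leaf_le) auto
        also have "\<dots> \<le> (real n / (2 * W)) powr (- w i)"
          using half n0 W w_pos[of i] i by (intro powr_mono2') (auto simp: field_simps)
        also have "\<dots> = (2 * W) powr w i * real n powr (- w i)"
          using n0 W by (simp add: powr_divide powr_minus field_simps)
        also have "\<dots> \<le> K1 * real n powr (- w i)"
          unfolding K1_def using i by (intro mult_right_mono member_le_sum) auto
        finally show "measure_pmf.expectation (wrt w n) (\<lambda>T. of_bool (i \<in> leaves n T)) \<le> K1 * real n powr (- w i)" .
      qed
      finally show ?thesis by (simp add: sum_distrib_left)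
    qed
    moreover have "0 \<le> K1 * (1 / real n)" using K1 by simp
    moreover have "0 \<le> \<bar>W * (1 - W)\<bar> * (\<Sum>i=2..k. real n powr (- w i))"
      by (intro mult_nonneg_nonneg sum_nonneg) auto
    ultimately show ?thesis unfolding K_def distrib_left distrib_right by linarith
  qed
  moreover have "K \<ge> 0" using K1 by (simp add: K_def)
  ultimately show ?thesis by blast
qed

text \<open>The variance of the late leaves is n / 12 up to a constant. The early leaves, at most k
  of them, change it by a covariance of order sqrt n.\<close>

lemma variance_bound:
  "\<exists>K\<ge>0. \<forall>n\<ge>k + 2. \<bar>leaves_var w n - real n / 12\<bar> \<le> K * sqrt (real n)"
proof -
  have W: "W > 0" by (rule sum_weights_pos)
  obtain K0 where K0: "K0 \<ge> 0" "\<And>m. m \<ge> 2 \<Longrightarrow> \<bar>measure_pmf.variance (leaf_chain W m) real - (W + real m) / 12\<bar> \<le> K0"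
    using variance_leaf_chain[OF W] by blast
  define K1 where "K1 = K0 + \<bar>W - real k\<bar> / 12"
  \<comment> \<open>The three summands account for the late leaves, for the covariance via sqrt v
    \<le> sqrt (K1 + 1) sqrt n, and for the early leaves; constants are absorbed by sqrt n \<ge>
    1.\<close>
  define K where "K = K1 + 2 * real k * sqrt (K1 + 1) + (real k)\<^sup>2"
  have K1: "K1 \<ge> 0" using K0 by (simp add: K1_def)
  have "\<bar>leaves_var w n - real n / 12\<bar> \<le> K * sqrt (real n)" if n: "n \<ge> k + 2" for n
  proof -
    define m where "m = n - k"
    have nm: "n = k + m" and m: "m \<ge> 2" using n k by (auto simp: m_def)
    have n1: "real n \<ge> 1" using n by simp
    define v where "v = measure_pmf.variance (wrt w n) (\<lambda>T. real (late_leaves n T))"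
    have v_eq: "v = measure_pmf.variance (leaf_chain W m) real"
      unfolding v_def nm expectation_late_leaves[of m real]
      by (rule expectation_late_leaves)
    have "\<bar>(W + real m) / 12 - real n / 12\<bar> = \<bar>W - real k\<bar> / 12"
      unfolding nm by (simp add: field_simps abs_if)
    then have v: "\<bar>v - real n / 12\<bar> \<le> K1"
      using K0(2)[OF m] unfolding v_eq K1_def by linarith
    have "v \<le> (K1 + 1) * real n"
      using v n1 mult_left_mono[OF n1 K1] by (simp add: distrib_right abs_le_iff)
    then have sv: "sqrt v \<le> sqrt (K1 + 1) * sqrt (real n)"
      by (simp add: real_sqrt_mult[symmetric])
    have sn: "sqrt (real n) \<ge> 1" using n1 by simp
    have "\<bar>leaves_var w n - v\<bar> \<le> 2 * real k * sqrt v + (real k)\<^sup>2"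
      unfolding v_def num_leaves_split
    proof (rule variance_perturbation[OF finite_wrt])
      fix T assume "T \<in> set_pmf (wrt w n)"
      then show "0 \<le> real (early_leaves n T) \<and> real (early_leaves n T) \<le> real k"
        using early_leaves_le[of T n] n by auto
    qed
    also have "\<dots> \<le> 2 * real k * (sqrt (K1 + 1) * sqrt (real n)) + (real k)\<^sup>2"
      using sv by (intro add_right_mono mult_left_mono) auto
    finally have "\<bar>leaves_var w n - real n / 12\<bar> \<le> K1 + 2 * real k * (sqrt (K1 + 1) * sqrt (real n)) + (real k)\<^sup>2"
      using v by linarith
    also have "\<dots> \<le> K1 * sqrt (real n) + 2 * real k * (sqrt (K1 + 1) * sqrt (real n)) + (real k)\<^sup>2 * sqrt (real n)"
      using mult_left_mono[OF sn K1] mult_left_mono[OF sn, of "(real k)\<^sup>2"] by simp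
    also have "\<dots> = K * sqrt (real n)" by (simp add: K_def algebra_simps)
    finally show ?thesis .
  qed
  moreover have "K \<ge> 0" using K1 by (simp add: K_def)
  ultimately show ?thesis by blast
qed

section \<open>Tail bound for the number of leaves\<close>

lemma num_leaves_bounds:
  assumes T: "T \<in> set_pmf (wrt w n)" and n: "n \<ge> 1"
  shows "1 \<le> num_leaves n T \<and> num_leaves n T \<le> real n"
proof
  \<comment> \<open>The last node has no children, since parents are smaller than their
    children.\<close>
  have "n \<in> leaves n T"
    using wrt_parent_less[OF T] n unfolding leaves_def by fastforce
  then have "card (leaves n T) \<noteq> 0" by auto
  then show "1 \<le> num_leaves n T" unfolding num_leaves_def by linarith
  have "card (leaves n T) \<le> card {1..n}"
    by (intro card_mono) (auto simp: leaves_def)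
  then show "num_leaves n T \<le> real n" by (simp add: num_leaves_def)
qed

text \<open>The number of early leaves and its mean both lie between 0 and k - 1, so they differ by
  at most k - 1.\<close>

lemma deviation_diff:
  assumes T: "T \<in> set_pmf (wrt w (k + m))" and m: "m \<ge> 1"
  shows "\<bar>(num_leaves (k + m) T - leaves_mean w (k + m)) -
    (real (late_leaves (k + m) T) - measure_pmf.expectation (leaf_chain W m) real)\<bar> \<le> real k - 1"
proof -
  have R: "0 \<le> real (early_leaves (k + m) T) \<and> real (early_leaves (k + m) T) \<le> real k - 1"
    if "T \<in> set_pmf (wrt w (k + m))" for T
    using early_leaves_le[OF that] m by simp
  let ?R = "measure_pmf.expectation (wrt w (k + m)) (\<lambda>T. real (early_leaves (k + m) T))"
  have ER: "0 \<le> ?R" "?R \<le> real k - 1"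
    using expectation_bounds[OF finite_wrt, of "k + m" 0 "\<lambda>T. real (early_leaves (k + m) T)" "real k - 1"] R by blast+
  show ?thesis
    unfolding num_leaves_split[of _ T] mean_split using R[OF T] ER by linarith
qed

lemma tail_bound:
  assumes n: "n \<ge> 1" and t: "t > 0" "t \<ge> 2 * real k - 2"
  shows "measure_pmf.prob (wrt w n) {T. \<bar>num_leaves n T - leaves_mean w n\<bar> \<ge> t}
           \<le> 2 * exp (- (6 * (t - 2 * real k + 2)\<^sup>2 / (real n - real k + 2 + W)))"
proof (cases "n > k")
  case True
  define m where "m = n - k"
  have nm: "n = k + m" and m: "m \<ge> 1" using True by (auto simp: m_def)
  define r where "r = t - 2 * real k + 2"
  have r0: "r \<ge> 0" using t by (simp add: r_def)
  \<comment> \<open>A deviation of all leaves by \<open>t\<close> forces one of the late leaves by t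
    - (k - 1), which is at least \<open>r\<close>.\<close>
  have rt: "r \<le> t - (real k - 1)" using k by (simp add: r_def)
  show ?thesis
  proof (cases "r = 0")
    \<comment> \<open>The right-hand side is then 2.\<close>
    case True
    have "measure_pmf.prob (wrt w n) A \<le> 2" for A
      using measure_pmf.prob_le_1[of "wrt w n" A] by linarith
    then show ?thesis using True unfolding r_def[symmetric] by simp
  next
    case False
    let ?E = "measure_pmf.expectation (leaf_chain W m) real"
    have "measure_pmf.prob (wrt w n) {T. \<bar>num_leaves n T - leaves_mean w n\<bar> \<ge> t} \<le>
        measure_pmf.prob (wrt w n) (late_leaves n -` {x. \<bar>real x - ?E\<bar> \<ge> r})"
    proof (rule measure_pmf.finite_measure_mono_AE)
      show "AE T in measure_pmf (wrt w n). T \<in> {T. \<bar>num_leaves n T - leaves_mean w n\<bar> \<ge> t} \<longrightarrow>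
          T \<in> late_leaves n -` {x. \<bar>real x - ?E\<bar> \<ge> r}"
        unfolding AE_measure_pmf_iff nm
        using deviation_diff[OF _ m] rt by fastforce
    qed simp
    also have "\<dots> = measure_pmf.prob (leaf_chain W m) {x. \<bar>real x - ?E\<bar> \<ge> r}"
      unfolding nm map_late_leaves[symmetric] by simp
    also have "\<dots> \<le> 2 * exp (- (6 * r\<^sup>2 / (real m + 2 + W)))"
      using False r0 by (intro leaf_chain_tail m sum_weights_pos) simp
    finally show ?thesis unfolding r_def nm by simp
  qed
next
  \<comment> \<open>For \<open>n \<le> k\<close> the denominator may be zero or negative, but the
    event is null: the number of leaves lies between 1 and n, so it deviates by at most n - 1 \<le>
    k - 1 < t.\<close>
  case False
  have "\<bar>num_leaves n T - leaves_mean w n\<bar> < t" if T: "T \<in> set_pmf (wrt w n)" for T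
  proof -
    note L = num_leaves_bounds[OF _ n]
    have EL: "1 \<le> leaves_mean w n" "leaves_mean w n \<le> real n"
      using expectation_bounds[OF finite_wrt, of n 1 "num_leaves n" "real n"] L by blast+
    have "\<bar>num_leaves n T - leaves_mean w n\<bar> \<le> real n - 1"
      using L[OF T] EL by linarith
    also have "\<dots> \<le> real k - 1" using False by simp
    also have "\<dots> < t" using t k by (cases "k = 1") auto
    finally show ?thesis .
  qed
  then have "measure_pmf.prob (wrt w n) {T. \<bar>num_leaves n T - leaves_mean w n\<bar> \<ge> t} = 0"
    by (subst measure_pmf_zero_iff) (auto simp: not_le[symmetric])
  then show ?thesis by simp
qed

text \<open>For t < 2 k - 2 the square is at most (2 k)^2, so for large n the exponent is at least -
  1 / 2, and the right-hand side is at least 2 exp (- 1 / 2) \<ge> 1.\<close>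

lemma tail_bound_eventually:
  "\<exists>N. \<forall>n\<ge>N. \<forall>t>0.
    measure_pmf.prob (wrt w n) {T. \<bar>num_leaves n T - leaves_mean w n\<bar> \<ge> t}
           \<le> 2 * exp (- (6 * (t - 2 * real k + 2)\<^sup>2 / (real n - real k + 2 + W)))"
proof (intro exI allI impI)
  fix n :: nat and t :: real
  \<comment> \<open>The threshold makes n - k at least 12 q with q = (2 k)^2, and 6 q / (12 q + 2 +
    W) \<le> 1 / 2.\<close>
  assume n: "n \<ge> k + 12 * (2 * k)\<^sup>2" and t: "t > 0"
  have W: "W > 0" by (rule sum_weights_pos)
  have n1: "n \<ge> 1" using n k by simp
  show "measure_pmf.prob (wrt w n) {T. \<bar>num_leaves n T - leaves_mean w n\<bar> \<ge> t}
           \<le> 2 * exp (- (6 * (t - 2 * real k + 2)\<^sup>2 / (real n - real k + 2 + W)))"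
  proof (cases "t \<ge> 2 * real k - 2")
    case True
    then show ?thesis using tail_bound n1 t by blast
  next
    case False
    have "(t - 2 * real k + 2)\<^sup>2 \<le> (2 * real k)\<^sup>2"
      using False t by (subst abs_le_square_iff[symmetric]) auto
    moreover have "real n \<ge> real k + 12 * (2 * real k)\<^sup>2"
      using of_nat_mono[OF n, where 'a = real] by simp
    moreover have "0 \<le> (2 * real k)\<^sup>2" by simp
    moreover have "6 * r / (y - x + 2 + v) \<le> 1 / 2"
      if "r \<le> q" "y \<ge> x + 12 * q" "0 \<le> q" "v > 0" for r q x y v :: real
      using that by (simp add: divide_le_eq)
    ultimately have "6 * (t - 2 * real k + 2)\<^sup>2 / (real n - real k + 2 + W) \<le> 1 / 2"
      using W by blast
    then have "exp (- (6 * (t - 2 * real k + 2)\<^sup>2 / (real n - real k + 2 + W))) \<ge> exp (- (1/2))"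
      by simp
    moreover have "exp (- (1/2)) \<ge> (1/2 :: real)" using exp_ge_add_one_self[of "- (1/2) :: real"] by simp
    moreover have "measure_pmf.prob (wrt w n) {T. \<bar>num_leaves n T - leaves_mean w n\<bar> \<ge> t} \<le> 1" by simp
    ultimately show ?thesis by linarith
  qed
qed

section \<open>Central limit theorem\<close>

lemma var_ratio: "(\<lambda>n. leaves_var w n / real n) \<longlonglongrightarrow> 1 / 12"
proof -
  obtain K where K: "K \<ge> 0" "\<And>n. n \<ge> k + 2 \<Longrightarrow> \<bar>leaves_var w n - real n / 12\<bar> \<le> K * sqrt (real n)"
    using variance_bound by blast
  have "(\<lambda>n. leaves_var w n / real n - 1 / 12) \<longlonglongrightarrow> 0"
  proof (rule Lim_null_comparison)
    show "eventually (\<lambda>n. norm (leaves_var w n / real n - 1 / 12) \<le> K / sqrt (real n)) sequentially"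
      using eventually_ge_at_top[of "k + 2"]
    proof eventually_elim
      case (elim n)
      have n: "real n > 0" using elim by simp
      have "leaves_var w n / real n - 1 / 12 = (leaves_var w n - real n / 12) / real n"
        using n by (simp add: field_simps)
      then have "norm (leaves_var w n / real n - 1 / 12) = \<bar>leaves_var w n - real n / 12\<bar> / real n"
        using n by (simp only: real_norm_def abs_divide)
      also have "\<dots> \<le> K * sqrt (real n) / real n"
        using K(2)[OF elim] by (rule divide_right_mono) simp
      also have "\<dots> = K / sqrt (real n)"
        using n by (simp add: real_divide_square_eq field_simps)
      finally show ?case .
    qed
    show "(\<lambda>n. K / sqrt (real n)) \<longlonglongrightarrow> 0"
      by (intro real_tendsto_divide_at_top[OF tendsto_const] filterlim_compose[OF sqrt_at_top filterlim_real_sequentially])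
  qed
  then show ?thesis by (simp add: LIM_zero_iff)
qed

text \<open>The characteristic function \<open>A\<close> of the standardised leaves is compared with
  \<open>B\<close>, that of the scaled martingale, then \<open>B\<close> with a Gaussian factor,
  whose exponent finally converges.\<close>

lemma char_leaves_tendsto:
  "(\<lambda>n. measure_pmf.expectation (wrt w n)
      (\<lambda>T. iexp (t * ((num_leaves n T - leaves_mean w n) / sqrt (leaves_var w n)))))
    \<longlonglongrightarrow> complex_of_real (exp (- t\<^sup>2 / 2))"
proof -
  have W: "W > 0" by (rule sum_weights_pos)
  obtain K where K: "K \<ge> 0" "\<And>m. \<bar>measure_pmf.expectation (leaf_chain W m) (\<lambda>x. (centred W m x)\<^sup>2) - (W + real m) / 12\<bar> \<le> K"
    using expectation_centred_sq_bounded[OF W] by blast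
  define \<sigma> where "\<sigma> n = sqrt (leaves_var w n)" for n
  define S where "S n = W + real (n - k)" for n
  \<comment> \<open>With this scaling, \<open>u n\<close> times the martingale is \<open>t\<close>
    times the deviation of the late leaves divided by \<open>\<sigma> n\<close>.\<close>
  define u where "u n = t / (\<sigma> n * (S n - 1))" for n
  define V where "V n = sqsum W (n - k)" for n
  define A where "A n = measure_pmf.expectation (wrt w n)
      (\<lambda>T. iexp (t * ((num_leaves n T - leaves_mean w n) / \<sigma> n)))" for n
  define B where "B n = measure_pmf.expectation (leaf_chain W (n - k)) (\<lambda>x. iexp (u n * leaf_martingale W (n - k) x))" for n
  have i: "(\<lambda>n. 1 / real n) \<longlonglongrightarrow> 0" by (rule lim_1_over_n)
  have n_gt: "eventually (\<lambda>n. n > k) sequentially" by (rule eventually_gt_at_top)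
  have Sn: "(\<lambda>n. S n / real n) \<longlonglongrightarrow> 1"
  proof (rule Lim_transform_eventually)
    have "(\<lambda>n. 1 + (W - real k) * (1 / real n)) \<longlonglongrightarrow> 1 + (W - real k) * 0"
      by (intro tendsto_intros i)
    then show "(\<lambda>n. 1 + (W - real k) * (1 / real n)) \<longlonglongrightarrow> 1" by simp
    show "eventually (\<lambda>n. 1 + (W - real k) * (1 / real n) = S n / real n) sequentially"
      using n_gt by eventually_elim (simp add: S_def of_nat_diff field_simps)
  qed
  have S1: "(\<lambda>n. (S n - 1) / real n) \<longlonglongrightarrow> 1"
    using tendsto_diff[OF Sn i] by (simp add: diff_divide_distrib)
  have var_pos: "eventually (\<lambda>n. leaves_var w n > 0) sequentially"
  proof -
    have "eventually (\<lambda>n. leaves_var w n / real n > 0) sequentially"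
      by (rule order_tendstoD(1)[OF var_ratio]) simp
    then show ?thesis by eventually_elim (simp add: zero_less_divide_iff)
  qed
  \<comment> \<open>The variance is close to n / 12 and S - 1 to n, so u^2 is close to 12 t^2 /
    n^3.\<close>
  have z: "(\<lambda>n. (u n)\<^sup>2 * real n ^ 3) \<longlonglongrightarrow> 12 * t\<^sup>2"
  proof (rule Lim_transform_eventually)
    have "(\<lambda>n. t\<^sup>2 / ((leaves_var w n / real n) * ((S n - 1) / real n)\<^sup>2)) \<longlonglongrightarrow> t\<^sup>2 / ((1 / 12) * 1\<^sup>2)"
      by (intro tendsto_intros var_ratio S1) auto
    then show "(\<lambda>n. t\<^sup>2 / ((leaves_var w n / real n) * ((S n - 1) / real n)\<^sup>2)) \<longlonglongrightarrow> 12 * t\<^sup>2"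
      by (simp add: mult.commute)
    show "eventually (\<lambda>n. t\<^sup>2 / ((leaves_var w n / real n) * ((S n - 1) / real n)\<^sup>2) = (u n)\<^sup>2 * real n ^ 3) sequentially"
      using var_pos n_gt
    proof eventually_elim
      case (elim n)
      define v where "v = leaves_var w n"
      have v: "v > 0" using elim by (simp add: v_def)
      have n: "real n > 0" using elim by simp
      have "S n - 1 > 0" using elim W by (simp add: S_def)
      then show ?case
        using v n unfolding u_def \<sigma>_def v_def[symmetric]
        by (simp add: power_divide power_mult_distrib) (simp add: field_simps eval_nat_numeral)
    qed
  qed
  \<comment> \<open>Together with the limit 12 t^2 this gives u^2 V / 8 the limit 12 t^2 / 24 = t^2
    / 2, the standard normal exponent.\<close>
  have Vn: "(\<lambda>n. V n / real n ^ 3) \<longlonglongrightarrow> 1 / 3"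
  proof (rule Lim_transform_eventually)
    define c where "c = W * (W + 1) * (2 * W + 1)"
    let ?g = "\<lambda>n. (((S n - 1) / real n) * (S n / real n) * (2 * (S n / real n) - 1 / real n) - c * (1 / real n) ^ 3) / 6"
    have "?g \<longlonglongrightarrow> (1 * 1 * (2 * 1 - 0) - c * 0 ^ 3) / 6"
      by (intro tendsto_intros Sn S1 i) auto
    then show "?g \<longlonglongrightarrow> 1 / 3" by simp
    show "eventually (\<lambda>n. ?g n = V n / real n ^ 3) sequentially"
      using n_gt
    proof eventually_elim
      case (elim n)
      have n: "real n > 0" using elim by simp
      have "6 * V n = (S n - 1) * S n * (2 * S n - 1) - c"
        unfolding V_def S_def c_def using elim by (intro sqsum_eq) simp
      then have V: "V n = ((S n - 1) * S n * (2 * S n - 1) - c) / 6" by simp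
      show ?case unfolding V using n by (simp add: field_simps eval_nat_numeral)
    qed
  qed
  have "(\<lambda>n. exp (- (((u n)\<^sup>2 * real n ^ 3) * (V n / real n ^ 3)) / 8)) \<longlonglongrightarrow> exp (- ((12 * t\<^sup>2) * (1 / 3)) / 8)"
    by (intro tendsto_intros z Vn) auto
  then have "(\<lambda>n. exp (- (((u n)\<^sup>2 * real n ^ 3) * (V n / real n ^ 3)) / 8)) \<longlonglongrightarrow> exp (- t\<^sup>2 / 2)"
    by simp
  then have "(\<lambda>n. exp (- (u n)\<^sup>2 * V n / 8)) \<longlonglongrightarrow> exp (- t\<^sup>2 / 2)"
    by (rule Lim_transform_eventually) (use n_gt in \<open>eventually_elim, simp\<close>)
  then have gauss: "(\<lambda>n. complex_of_real (exp (- (u n)\<^sup>2 * V n / 8))) \<longlonglongrightarrow> complex_of_real (exp (- t\<^sup>2 / 2))"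
    by (rule tendsto_of_real)
  have BV: "(\<lambda>n. B n - complex_of_real (exp (- (u n)\<^sup>2 * V n / 8))) \<longlonglongrightarrow> 0"
  proof (rule Lim_null_comparison)
    show "eventually (\<lambda>n. norm (B n - complex_of_real (exp (- (u n)\<^sup>2 * V n / 8))) \<le>
        S n * (\<bar>u n\<bar> ^ 3 * S n ^ 3 / 6 + u n ^ 4 * S n ^ 4 / 128 + (u n)\<^sup>2 / 2 * (K + S n / 12))) sequentially"
      using n_gt
    proof eventually_elim
      case (elim n)
      have "measure_pmf.expectation (leaf_chain W m) (\<lambda>x. (centred W m x)\<^sup>2) \<le> K + (W + real m) / 12" for m
        using K(2)[of m] by linarith
      then show ?case unfolding B_def V_def S_def using elim by (intro leaf_martingale_char_approx W) auto
    qed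
    show "(\<lambda>n. S n * (\<bar>u n\<bar> ^ 3 * S n ^ 3 / 6 + u n ^ 4 * S n ^ 4 / 128 + (u n)\<^sup>2 / 2 * (K + S n / 12))) \<longlonglongrightarrow> 0"
      by (rule tendsto_char_error[OF Sn z]) (use W in \<open>simp add: S_def add_nonneg_nonneg\<close>)
  qed
  \<comment> \<open>The deviations of all leaves and of late leaves differ by at most k, which is
    negligible after division by \<open>\<sigma> n\<close>, as this tends to infinity.\<close>
  have AB: "(\<lambda>n. A n - B n) \<longlonglongrightarrow> 0"
  proof (rule Lim_null_comparison)
    show "eventually (\<lambda>n. norm (A n - B n) \<le> \<bar>t\<bar> * real k / \<sigma> n) sequentially"
      using var_pos n_gt
    proof eventually_elim
      case (elim n)
      define m where "m = n - k"
      have nm: "n = k + m" and m: "m \<ge> 1" using elim by (auto simp: m_def)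
      have \<sigma>: "\<sigma> n > 0" using elim by (simp add: \<sigma>_def)
      have y: "S n - 1 > 0" using elim W by (simp add: S_def)
      let ?L = "\<lambda>T. t * ((num_leaves n T - leaves_mean w n) / \<sigma> n)"
      let ?X = "\<lambda>T. u n * leaf_martingale W m (late_leaves n T)"
      have B: "B n = measure_pmf.expectation (wrt w n) (\<lambda>T. iexp (?X T))"
        unfolding B_def m_def[symmetric] unfolding nm by (rule expectation_late_leaves[symmetric])
      have "A n - B n = measure_pmf.expectation (wrt w n) (\<lambda>T. iexp (?L T) - iexp (?X T))"
        unfolding A_def B by (rule Bochner_Integration.integral_diff[symmetric]) simp_all
      also have "norm \<dots> \<le> measure_pmf.expectation (wrt w n) (\<lambda>_. \<bar>t\<bar> * real k / \<sigma> n)"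
      proof (rule norm_expectation_le[OF finite_wrt])
        fix T assume T: "T \<in> set_pmf (wrt w n)"
        let ?d = "(num_leaves n T - leaves_mean w n) - (real (late_leaves n T) - measure_pmf.expectation (leaf_chain W m) real)"
        have d: "\<bar>?d\<bar> \<le> real k"
          using deviation_diff[of T m] T m unfolding nm by linarith
        have "leaf_martingale W m (late_leaves n T) = (S n - 1) * (real (late_leaves n T) - measure_pmf.expectation (leaf_chain W m) real)"
          unfolding leaf_martingale_eq_deviation[OF W] S_def m_def ..
        then have X: "?X T = t * ((real (late_leaves n T) - measure_pmf.expectation (leaf_chain W m) real) / \<sigma> n)"
          using y by (simp add: u_def)
        have "?L T - ?X T = t / \<sigma> n * ?d"
          unfolding X by (simp add: algebra_simps diff_divide_distrib add_divide_distrib)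
        then have "\<bar>?L T - ?X T\<bar> = \<bar>t\<bar> / \<sigma> n * \<bar>?d\<bar>"
          using \<sigma> by (simp only: abs_mult abs_divide abs_of_pos)
        also have "\<dots> \<le> \<bar>t\<bar> / \<sigma> n * real k"
          using \<sigma> d by (intro mult_left_mono) auto
        finally show "norm (iexp (?L T) - iexp (?X T)) \<le> \<bar>t\<bar> * real k / \<sigma> n"
          using norm_iexp_diff_le[of "?L T" "?X T"] by simp
      qed
      finally show ?case by simp
    qed
    have "filterlim (\<lambda>n. leaves_var w n / real n * real n) at_top sequentially"
      by (rule filterlim_tendsto_pos_mult_at_top[OF var_ratio _ filterlim_real_sequentially]) simp
    then have "filterlim (\<lambda>n. leaves_var w n) at_top sequentially"
      by (rule filterlim_mono_eventually)
        (use n_gt in \<open>auto elim: eventually_mono\<close>)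
    then have "filterlim \<sigma> at_top sequentially"
      unfolding \<sigma>_def by (rule filterlim_compose[OF sqrt_at_top])
    then show "(\<lambda>n. \<bar>t\<bar> * real k / \<sigma> n) \<longlonglongrightarrow> 0"
      by (intro real_tendsto_divide_at_top[OF tendsto_const])
  qed
  have "A \<longlonglongrightarrow> complex_of_real (exp (- t\<^sup>2 / 2))"
    using tendsto_add[OF tendsto_add[OF AB BV] gauss] by simp
  then show ?thesis unfolding A_def[abs_def] \<sigma>_def .
qed

lemma leaves_clt:
  "weak_conv_m
    (\<lambda>n. distr (measure_pmf (wrt w n)) borel
      (\<lambda>T. (num_leaves n T - leaves_mean w n) / sqrt (leaves_var w n)))
    std_normal_distribution"
proof (rule levy_continuity)
  show "real_distribution (distr (measure_pmf (wrt w n)) borel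
      (\<lambda>T. (num_leaves n T - leaves_mean w n) / sqrt (leaves_var w n)))" for n
    by (intro prob_space.real_distribution_distr measure_pmf.prob_space_axioms) simp
  show "real_distribution std_normal_distribution"
    by (rule real_dist_normal_dist)
  show "(\<lambda>n. char (distr (measure_pmf (wrt w n)) borel
      (\<lambda>T. (num_leaves n T - leaves_mean w n) / sqrt (leaves_var w n))) t)
    \<longlonglongrightarrow> char std_normal_distribution t" for t
    using char_leaves_tendsto[of t]
    unfolding char_std_normal_distribution char_def by (simp add: integral_distr)
qed

section \<open>Landau form of the moment estimates and conclusion\<close>

lemma mean_bigo:
  "(\<lambda>n. leaves_mean w n - (real n / 2 + (W - real k) / 2))
     \<in> O(\<lambda>n. 1 / real n + (\<Sum>i=2..k. real n powr (- w i)))"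
proof -
  obtain K where K: "\<And>n. n \<ge> 2 * k + 2 \<Longrightarrow> \<bar>leaves_mean w n - (real n / 2 + (W - real k) / 2)\<bar> \<le>
    K * (1 / real n + (\<Sum>i=2..k. real n powr (- w i)))"
    using mean_bound by blast
  show ?thesis
  proof (rule bigoI)
    show "eventually (\<lambda>n. norm (leaves_mean w n - (real n / 2 + (W - real k) / 2)) \<le>
        K * norm (1 / real n + (\<Sum>i=2..k. real n powr (- w i)))) sequentially"
      using eventually_ge_at_top[of "2 * k + 2"]
    proof eventually_elim
      case (elim n)
      have "0 \<le> 1 / real n + (\<Sum>i=2..k. real n powr (- w i))"
        by (intro add_nonneg_nonneg sum_nonneg) auto
      then show ?case using K[OF elim] by (simp only: real_norm_def abs_of_nonneg)
    qed
  qed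
qed

lemma mean_bigo_ge_1:
  assumes "\<forall>i\<in>{2..k}. w i \<ge> 1"
  shows "(\<lambda>n. leaves_mean w n - (real n / 2 + (W - real k) / 2)) \<in> O(\<lambda>n. 1 / real n)"
proof (rule landau_o.big_trans[OF mean_bigo], rule bigoI)
  show "eventually (\<lambda>n. norm (1 / real n + (\<Sum>i=2..k. real n powr (- w i))) \<le> (1 + real k) * norm (1 / real n)) sequentially"
    using eventually_ge_at_top[of 1]
  proof eventually_elim
    case (elim n)
    have "(\<Sum>i=2..k. real n powr (- w i)) \<le> (\<Sum>i=2..k. 1 / real n)"
    proof (rule sum_mono)
      fix i assume "i \<in> {2..k}"
      then have "real n powr (- w i) \<le> real n powr (- 1)"
        using assms elim by (intro powr_mono) auto
      then show "real n powr (- w i) \<le> 1 / real n"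
        using elim by (simp add: powr_minus_divide)
    qed
    also have "\<dots> \<le> real k * (1 / real n)"
      unfolding sum_constant by (intro mult_right_mono) auto
    finally have "1 / real n + (\<Sum>i=2..k. real n powr (- w i)) \<le> (1 + real k) * (1 / real n)"
      by (simp add: add_divide_distrib)
    moreover have "0 \<le> 1 / real n + (\<Sum>i=2..k. real n powr (- w i))"
      by (intro add_nonneg_nonneg sum_nonneg) auto
    ultimately show ?case by simp
  qed
qed

lemma var_bigo: "(\<lambda>n. leaves_var w n - real n / 12) \<in> O(\<lambda>n. sqrt (real n))"
proof -
  obtain K where K: "\<And>n. n \<ge> k + 2 \<Longrightarrow> \<bar>leaves_var w n - real n / 12\<bar> \<le> K * sqrt (real n)"
    using variance_bound by blast
  show ?thesis
    by (rule bigoI[of _ K], rule eventually_mono[OF eventually_ge_at_top[of "k + 2"]])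
      (use K in \<open>simp only: real_norm_def real_sqrt_abs2 abs_of_nonneg real_sqrt_ge_zero of_nat_0_le_iff\<close>)
qed

end

text \<open>The bound n powr (- w i) for the survival of an early leaf decays more slowly than 1 / n
  when w i < 1. The error of the mean therefore carries these terms in general and is of order 1 / n
  when the weights of the nodes 2 to k are at least 1. The square (t - 2 k + 2)^2 grows again as t
  falls below 2 k - 2, so the tail bound is stated for all t > 0 at large n, and for t \<ge> 2 k - 2
  at every n \<ge> 1.\<close>

theorem theorem3p2:
  fixes w :: "nat \<Rightarrow> real" and k :: nat
  assumes "\<And>i. i \<ge> 1 \<Longrightarrow> w i > 0"
    and "k \<ge> 1"
    and "\<And>i. i > k \<Longrightarrow> w i = 1"
  shows
    "(\<exists>C. \<bar>C\<bar> \<le> ((\<Sum>i=1..k. w i) + real k) / 2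
        \<and> ((\<forall>i\<in>{2..k}. w i \<ge> 1) \<longrightarrow>
             (\<lambda>n. leaves_mean w n - (real n / 2 + C)) \<in> O(\<lambda>n. 1 / real n))
        \<and> (\<lambda>n. leaves_mean w n - (real n / 2 + C))
             \<in> O(\<lambda>n. 1 / real n + (\<Sum>i=2..k. real n powr (- w i))))
     \<and> (\<lambda>n. leaves_var w n - real n / 12) \<in> O(\<lambda>n. sqrt (real n))
     \<and> ((\<exists>N. \<forall>n\<ge>N. \<forall>t>0.
           measure_pmf.prob (wrt w n) {T. \<bar>num_leaves n T - leaves_mean w n\<bar> \<ge> t}
           \<le> 2 * exp (- (6 * (t - 2 * real k + 2)\<^sup>2
                            / (real n - real k + 2 + (\<Sum>i=1..k. w i)))))
        \<and> (\<forall>n\<ge>1. \<forall>t>0. t \<ge> 2 * real k - 2 \<longrightarrow>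
           measure_pmf.prob (wrt w n) {T. \<bar>num_leaves n T - leaves_mean w n\<bar> \<ge> t}
           \<le> 2 * exp (- (6 * (t - 2 * real k + 2)\<^sup>2
                            / (real n - real k + 2 + (\<Sum>i=1..k. w i))))))
     \<and> weak_conv_m
         (\<lambda>n. distr (measure_pmf (wrt w n)) borel
                (\<lambda>T. (num_leaves n T - leaves_mean w n) / sqrt (leaves_var w n)))
         std_normal_distribution"
proof -
  interpret eventually_unit_weights w k
    by unfold_locales (fact assms)+
  \<comment> \<open>The constant of the mean is C = (W - k) / 2.\<close>
  have "\<bar>(W - real k) / 2\<bar> \<le> (W + real k) / 2"
    using sum_weights_pos by (simp add: abs_le_iff)
  then show ?thesis
    using mean_bigo mean_bigo_ge_1 var_bigo tail_bound_eventually tail_bound leaves_clt by blast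
qed
end
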